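(* Let $A=\sigma(R)\langle x_1,\dots,x_n\rangle$ be a bijective skew PBW extension of an LGS ring $R$, with $\mathrm{Mon}(A)$ endowed with a monomial order. Let $I\neq 0$ be a left ideal of $A$ and let $G$ be a finite set of non-zero elements of $I$ that generates $I$ as a left ideal. Then the following conditions are equivalent: (i) $G$ is a Gröbner basis of $I$. (ii) For all $F:=\{g_1,\dots,g_s\}\subseteq G$ and for any $(b_1,\dots,b_s)\in B_F$, one has $\sum_{i=1}^s b_i x^{\gamma_i} g_i \xrightarrow{\,G\,}_+ 0$.
   Context: Rings are associative with unit; $\mathbb N$ contains $0$. Skew PBW extensions. Let $R\subseteq A$ be rings. $A$ is a skew PBW extension of $R$, written $A=\sigma(R)\langle x_1,\dots,x_n\rangle$, if: (1) there are $x_1,\dots,x_n\in A$ such that $A$ is a free left $R$-module with basis $\mathrm{Mon}(A)=\{x^\alpha=x_1^{\alpha_1}\cdots x_n^{\alpha_n}\mid \alpha\in\mathbb N^n\}$; (2) for every $i$ and $r\in R\setminus\{0\}$ there is $c_{i,r}\in R\setminus\{0\}$ with $x_ir-c_{i,r}x_i\in R$; (3) for all $1\le i,j\le n$ there is $c_{i,j}\in R\setminus\{0\}$ with $x_jx_i-c_{i,j}x_ix_j\in R+Rx_1+\cdots+Rx_n$. Then for each $i$ there are an injective ring endomorphism $\sigma_i$ of $R$ and a $\sigma_i$-derivation $\delta_i$ of $R$ with $x_ir=\sigma_i(r)x_i+\delta_i(r)$ for all $r\in R$. $A$ is bijective if every $\sigma_i$ is bijective and $c_{i,j}$ is invertible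 for all $1\le i<j\le n$. Put $\sigma^\alpha:=\sigma_1^{\alpha_1}\cdots\sigma_n^{\alpha_n}$, $|\alpha|:=\alpha_1+\cdots+\alpha_n$, $\exp(x^\alpha):=\alpha$, $\deg(x^\alpha):=|\alpha|$, and for non-zero $f\in A$ let $\deg(f)$ be the maximal degree of its monomials. For $\alpha,\beta\in\mathbb N^n$ there are unique $c_{\alpha,\beta}\in R$, $p_{\alpha,\beta}\in A$ with $x^\alpha x^\beta=c_{\alpha,\beta}x^{\alpha+\beta}+p_{\alpha,\beta}$, where $p_{\alpha,\beta}=0$ or $\deg(p_{\alpha,\beta})<|\alpha+\beta|$. LGS rings. $R$ is left Gröbner soluble (LGS) if $R$ is left Noetherian; there is an algorithm deciding, for $a,r_1,\dots,r_m\in R$, whether $a\in Rr_1+\cdots+Rr_m$ and, if so, finding $b_i$ with $a=\sum b_ir_i$; and there is an algorithm computing a finite generating set of the left $R$-module $\mathrm{Syz}_R[r_1\ \cdots\ r_m]:=\{(b_1,\dots,b_m)\in R^m\mid b_1r_1+\cdots+b_mr_m=0\}$. Monomial orders. For a total order $\succeq$ on $\mathrm{Mon}(A)$ and $0\neq f=c_1X_1+\cdots+c_tX_t$ with $c_i\in R\setminus\{0\}$ and $X_1\succ\cdots\succ X_t$ in $\mathrm{Mon}(A)$, put $lm(f):=X_1$, $lc(f):=c_1$; also $lm(0)=0$, $lc(0)=0$ and $X\succ 0$ for all monomials $X$. $\succeq$ is a monomial order if: $x^\beta\succeq x^\alpha$ implies $lm(x^\gamma x^\beta x^\lambda)\succeq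 lm(x^\gamma x^\alpha x^\lambda)$ for all $\gamma,\lambda$; $x^\alpha\succeq 1$ for all $\alpha$; and $|\beta|>|\alpha|$ implies $x^\beta\succeq x^\alpha$. $x^\alpha$ divides $x^\beta$ iff $\beta-\alpha\in\mathbb N^n$; the least common multiple of monomials is given by componentwise maxima of exponents. Reduction. Let $F$ be a finite set of non-zero elements of $A$. $f\xrightarrow{F}h$ (one step) means there are $f_1,\dots,f_t\in F$, $r_1,\dots,r_t\in R$ and $\alpha_i\in\mathbb N^n$ with $\alpha_i+\exp(lm(f_i))=\exp(lm(f))$ for all $i$, $lc(f)=\sum_{i} r_i\sigma^{\alpha_i}(lc(f_i))c_{\alpha_i,\exp(lm(f_i))}$, and $h=f-\sum_i r_ix^{\alpha_i}f_i$; by convention $0\xrightarrow{F}0$. $f\xrightarrow{F}_+h$ means $h$ is obtained from $f$ by finitely many one-step reductions. A non-zero $f$ is reducible w.r.t. $F$ if a one-step reduction of $f$ by $F$ exists; otherwise (or if $f=0$) it is reduced. Gröbner bases. For a left ideal $I\neq0$ of $A$, a non-empty finite set $G$ of non-zero elements of $I$ is a Gröbner basis for $I$ if every $0\neq f\in I$ is reducible w.r.t. $G$. $\{0\}$ is a Gröbner basis of the zero ideal. The sets $B_F$. For $F=\{g_1,\dots,g_s\}\subseteq A\setminus\{0\}$, let $X_F$ be the least common multiple of $lm(g_1),\dots,lm(g_s)$, $\beta_i:=\exp(lm(g_i))$, and $\gamma_i\in\mathbb N^n$ with $\gamma_i+\beta_i=\exp(X_F)$. $B_F$ denotes a (fixed)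 finite generating set of the left $R$-module $S_F:=\mathrm{Syz}_R[\sigma^{\gamma_1}(lc(g_1))c_{\gamma_1,\beta_1}\ \cdots\ \sigma^{\gamma_s}(lc(g_s))c_{\gamma_s,\beta_s}]$. *)

theory Defs
  imports Complex_Main "HOL-Library.FuncSet" "HOL-Library.Function_Algebras"
begin

section \<open>Subrings, left ideals, syzygies\<close>

text \<open>
  The big ring \<open>A\<close> is the whole type \<open>'a :: ring_1\<close>; the coefficient ring \<open>R\<close> is a
  unital subring of it, given as a set.
\<close>

definition is_subring :: "'a::ring_1 set \<Rightarrow> bool" where
  "is_subring R \<longleftrightarrow> 1 \<in> R \<and> (\<forall>a\<in>R. \<forall>b\<in>R. a - b \<in> R \<and> a * b \<in> R)"

text \<open>
  \<open>left_ideal S J\<close>: \<open>J\<close> is a left ideal of the subring \<open>S\<close>. Hence \<open>left_ideal S hull X\<close> is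
  the left ideal of \<open>S\<close> generated by \<open>X \<subseteq> S\<close>, and left ideals of \<open>A\<close> are the case
  \<open>S = UNIV\<close>.
\<close>

definition left_ideal :: "'a::ring_1 set \<Rightarrow> 'a set \<Rightarrow> bool" where
  "left_ideal S J \<longleftrightarrow> J \<subseteq> S \<and> 0 \<in> J \<and> (\<forall>a\<in>J. \<forall>b\<in>J. a + b \<in> J) \<and> (\<forall>s\<in>S. \<forall>a\<in>J. s * a \<in> J)"

definition left_noetherian :: "'a::ring_1 set \<Rightarrow> bool" where
  "left_noetherian R \<longleftrightarrow>
     (\<forall>J. left_ideal R J \<longrightarrow> (\<exists>X. finite X \<and> X \<subseteq> J \<and> J = left_ideal R hull X))"

definition invertible_in :: "'a::ring_1 set \<Rightarrow> 'a \<Rightarrow> bool" where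
  "invertible_in R c \<longleftrightarrow> c \<in> R \<and> (\<exists>d\<in>R. c * d = 1 \<and> d * c = 1)"

text \<open>
  Tuples over \<open>R\<close> are families indexed by a finite set \<open>K\<close> (extensional functions on \<open>K\<close>).
\<close>

definition Syz :: "'a::ring_1 set \<Rightarrow> 'k set \<Rightarrow> ('k \<Rightarrow> 'a) \<Rightarrow> ('k \<Rightarrow> 'a) set" where
  "Syz R K r = {b \<in> K \<rightarrow>\<^sub>E R. (\<Sum>k\<in>K. b k * r k) = 0}"

text \<open>\<open>B\<close> is a finite generating set of the left \<open>R\<close>-module \<open>M\<close> of \<open>K\<close>-indexed tuples.\<close>

definition finite_generating_set ::
    "'a::ring_1 set \<Rightarrow> 'k set \<Rightarrow> ('k \<Rightarrow> 'a) set \<Rightarrow> ('k \<Rightarrow> 'a) set \<Rightarrow> bool" where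
  "finite_generating_set R K M B \<longleftrightarrow> finite B \<and> B \<subseteq> M \<and>
     M = {(\<lambda>k\<in>K. \<Sum>b\<in>B. a b * b k) | a. a \<in> B \<rightarrow> R}"


section \<open>Left Groebner soluble rings\<close>

text \<open>
  The notion of algorithm is relative to a model of computation, which is left arbitrary:
  elements of \<open>R\<close> are represented by codes, \<open>C\<close> is the set of valid codes, \<open>val c\<close> is the
  element represented by \<open>c\<close> (an element may have several codes), and \<open>Alg\<close> is the set of those
  partial functions, from lists of codes to lists of lists of codes, that are computed by an
  algorithm of the model; \<open>None\<close> means that the computation does not terminate.  For instance,
  for \<open>'c = nat\<close> and \<open>Alg\<close> the partial recursive functions this is computability with respect
  to a numbering of a countable ring.
\<close>

text \<open>
  On input \<open>c # cs\<close> the algorithm returns \<open>[]\<close> if the element coded by \<open>c\<close> is not in the left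
  ideal generated by the elements coded by \<open>cs\<close>, and otherwise \<open>[ds]\<close> where \<open>ds\<close> codes
  coefficients witnessing membership.
\<close>

definition solves_membership ::
    "'c set \<Rightarrow> ('c \<Rightarrow> 'a::ring_1) \<Rightarrow> 'a set \<Rightarrow> ('c list \<Rightarrow> 'c list list option) \<Rightarrow> bool" where
  "solves_membership C val R f \<longleftrightarrow>
     (\<forall>c\<in>C. \<forall>cs\<in>lists C.
        if \<exists>b\<in>{..<length cs} \<rightarrow> R. val c = (\<Sum>i<length cs. b i * val (cs ! i))
        then \<exists>ds\<in>lists C. f (c # cs) = Some [ds] \<and> length ds = length cs \<and>
               val c = (\<Sum>i<length cs. val (ds ! i) * val (cs ! i))
        else f (c # cs) = Some [])"

definition solves_syzygies ::
    "'c set \<Rightarrow> ('c \<Rightarrow> 'a::ring_1) \<Rightarrow> 'a set \<Rightarrow> ('c list \<Rightarrow> 'c list list option) \<Rightarrow> bool" where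
  "solves_syzygies C val R f \<longleftrightarrow>
     (\<forall>cs\<in>lists C. \<exists>dss. f cs = Some dss \<and>
        (\<forall>ds\<in>set dss. ds \<in> lists C \<and> length ds = length cs) \<and>
        finite_generating_set R {..<length cs} (Syz R {..<length cs} (\<lambda>i. val (cs ! i)))
          ((\<lambda>ds. \<lambda>i\<in>{..<length cs}. val (ds ! i)) ` set dss))"

definition LGS ::
    "'c set \<Rightarrow> ('c \<Rightarrow> 'a::ring_1) \<Rightarrow> ('c list \<Rightarrow> 'c list list option) set \<Rightarrow> 'a set \<Rightarrow> bool" where
  "LGS C val Alg R \<longleftrightarrow> left_noetherian R \<and> val ` C = R \<and>
     (\<exists>f\<in>Alg. solves_membership C val R f) \<and> (\<exists>f\<in>Alg. solves_syzygies C val R f)"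


section \<open>Skew PBW extensions\<close>

text \<open>
  The variables are \<open>x 0, \<dots>, x (n - 1)\<close>; exponent vectors in \<open>\<nat>\<^sup>n\<close> are functions
  \<open>nat \<Rightarrow> nat\<close> vanishing from \<open>n\<close> on, added pointwise.
\<close>

definition expo :: "nat \<Rightarrow> (nat \<Rightarrow> nat) set" where
  "expo n = {\<alpha>. \<forall>i\<ge>n. \<alpha> i = 0}"

definition total_deg :: "nat \<Rightarrow> (nat \<Rightarrow> nat) \<Rightarrow> nat" where
  "total_deg n \<alpha> = (\<Sum>i<n. \<alpha> i)"

definition mon :: "nat \<Rightarrow> (nat \<Rightarrow> 'a::ring_1) \<Rightarrow> (nat \<Rightarrow> nat) \<Rightarrow> 'a" where
  "mon n x \<alpha> = prod_list (map (\<lambda>i. x i ^ \<alpha> i) [0..<n])"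

definition Mon :: "nat \<Rightarrow> (nat \<Rightarrow> 'a::ring_1) \<Rightarrow> 'a set" where
  "Mon n x = mon n x ` expo n"

definition exp_of :: "nat \<Rightarrow> (nat \<Rightarrow> 'a::ring_1) \<Rightarrow> 'a \<Rightarrow> (nat \<Rightarrow> nat)" where
  "exp_of n x X = (THE \<alpha>. \<alpha> \<in> expo n \<and> mon n x \<alpha> = X)"

definition represents ::
    "'a::ring_1 set \<Rightarrow> nat \<Rightarrow> (nat \<Rightarrow> 'a) \<Rightarrow> ((nat \<Rightarrow> nat) \<Rightarrow> 'a) \<Rightarrow> 'a \<Rightarrow> bool" where
  "represents R n x c f \<longleftrightarrow>
     range c \<subseteq> R \<and> finite {\<alpha>. c \<alpha> \<noteq> 0} \<and> {\<alpha>. c \<alpha> \<noteq> 0} \<subseteq> expo n \<and>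
     f = (\<Sum>\<alpha> | c \<alpha> \<noteq> 0. c \<alpha> * mon n x \<alpha>)"

text \<open>\<open>lin_part R n x\<close> is \<open>R + R x\<^sub>1 + \<dots> + R x\<^sub>n\<close>.\<close>

definition lin_part :: "'a::ring_1 set \<Rightarrow> nat \<Rightarrow> (nat \<Rightarrow> 'a) \<Rightarrow> 'a set" where
  "lin_part R n x = {s + (\<Sum>k<n. r k * x k) | s r. s \<in> R \<and> r \<in> {..<n} \<rightarrow> R}"

text \<open>
  In the first condition the monomials form a basis as a family indexed by exponent vectors, so
  distinct exponent vectors give distinct monomials.
\<close>

definition skew_PBW :: "'a::ring_1 set \<Rightarrow> nat \<Rightarrow> (nat \<Rightarrow> 'a) \<Rightarrow> bool" where
  "skew_PBW R n x \<longleftrightarrow> is_subring R \<and>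
     (\<forall>f. \<exists>!c. represents R n x c f) \<and>
     (\<forall>i<n. \<forall>r\<in>R - {0}. \<exists>c\<in>R - {0}. x i * r - c * x i \<in> R) \<and>
     (\<forall>i<n. \<forall>j<n. \<exists>c\<in>R - {0}. x j * x i - c * x i * x j \<in> lin_part R n x)"

text \<open>
  The following four descriptions are meant for a skew PBW extension, where each of the objects
  is uniquely determined (\<open>comm_coeff\<close> for \<open>i < j < n\<close>).  \<open>sigma R x i\<close> is the endomorphism of
  \<open>R\<close> with \<open>x i * r = sigma R x i r * x i + \<delta>\<close> for some \<open>\<delta> \<in> R\<close>.
\<close>

definition sigma :: "'a::ring_1 set \<Rightarrow> (nat \<Rightarrow> 'a) \<Rightarrow> nat \<Rightarrow> 'a \<Rightarrow> 'a" where
  "sigma R x i r = (THE s. s \<in> R \<and> x i * r - s * x i \<in> R)"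

definition comm_coeff :: "'a::ring_1 set \<Rightarrow> nat \<Rightarrow> (nat \<Rightarrow> 'a) \<Rightarrow> nat \<Rightarrow> nat \<Rightarrow> 'a" where
  "comm_coeff R n x i j =
     (THE c. c \<in> R - {0} \<and> x j * x i - c * x i * x j \<in> lin_part R n x)"

definition coef :: "'a::ring_1 set \<Rightarrow> nat \<Rightarrow> (nat \<Rightarrow> 'a) \<Rightarrow> 'a \<Rightarrow> (nat \<Rightarrow> nat) \<Rightarrow> 'a" where
  "coef R n x f = (THE c. represents R n x c f)"

definition deg :: "'a::ring_1 set \<Rightarrow> nat \<Rightarrow> (nat \<Rightarrow> 'a) \<Rightarrow> 'a \<Rightarrow> nat" where
  "deg R n x f = Max (total_deg n ` {\<alpha>. coef R n x f \<alpha> \<noteq> 0})"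

definition mult_coeff ::
    "'a::ring_1 set \<Rightarrow> nat \<Rightarrow> (nat \<Rightarrow> 'a) \<Rightarrow> (nat \<Rightarrow> nat) \<Rightarrow> (nat \<Rightarrow> nat) \<Rightarrow> 'a" where
  "mult_coeff R n x \<alpha> \<beta> = (THE c. c \<in> R \<and>
     (\<exists>p. mon n x \<alpha> * mon n x \<beta> = c * mon n x (\<alpha> + \<beta>) + p \<and>
          (p = 0 \<or> deg R n x p < total_deg n (\<alpha> + \<beta>))))"

definition bijective_skew_PBW :: "'a::ring_1 set \<Rightarrow> nat \<Rightarrow> (nat \<Rightarrow> 'a) \<Rightarrow> bool" where
  "bijective_skew_PBW R n x \<longleftrightarrow> skew_PBW R n x \<and>
     (\<forall>i<n. bij_betw (sigma R x i) R R) \<and>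
     (\<forall>i j. i < j \<and> j < n \<longrightarrow> invertible_in R (comm_coeff R n x i j))"

text \<open>\<open>\<sigma>\<^sup>\<alpha> = \<sigma>\<^sub>1\<^bsup>\<alpha>\<^sub>1\<^esup> \<circ> \<dots> \<circ> \<sigma>\<^sub>n\<^bsup>\<alpha>\<^sub>n\<^esup>\<close>, the last factor being applied first.\<close>

definition sigma_pow :: "'a::ring_1 set \<Rightarrow> nat \<Rightarrow> (nat \<Rightarrow> 'a) \<Rightarrow> (nat \<Rightarrow> nat) \<Rightarrow> 'a \<Rightarrow> 'a" where
  "sigma_pow R n x \<alpha> = foldr (\<lambda>i h. (sigma R x i ^^ \<alpha> i) \<circ> h) [0..<n] id"


section \<open>Monomial orders, reduction, Groebner bases\<close>

text \<open>
  An order on \<open>Mon n x\<close> is a relation \<open>ord\<close> where \<open>(Y, X) \<in> ord\<close> means \<open>X \<succeq> Y\<close>.  The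
  predicate \<open>mon_ge\<close> extends it by the convention that every monomial is above \<open>0\<close>.
\<close>

definition mon_ge :: "'a::ring_1 rel \<Rightarrow> 'a \<Rightarrow> 'a \<Rightarrow> bool" where
  "mon_ge ord X Y \<longleftrightarrow> Y = 0 \<or> (Y, X) \<in> ord"

definition lm :: "'a::ring_1 set \<Rightarrow> nat \<Rightarrow> (nat \<Rightarrow> 'a) \<Rightarrow> 'a rel \<Rightarrow> 'a \<Rightarrow> 'a" where
  "lm R n x ord f = (if f = 0 then 0 else
     (THE X. X \<in> mon n x ` {\<alpha>. coef R n x f \<alpha> \<noteq> 0} \<and>
        (\<forall>Y\<in>mon n x ` {\<alpha>. coef R n x f \<alpha> \<noteq> 0}. (Y, X) \<in> ord)))"

definition lc :: "'a::ring_1 set \<Rightarrow> nat \<Rightarrow> (nat \<Rightarrow> 'a) \<Rightarrow> 'a rel \<Rightarrow> 'a \<Rightarrow> 'a" where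
  "lc R n x ord f = (if f = 0 then 0 else coef R n x f (exp_of n x (lm R n x ord f)))"

abbreviation lexp :: "'a::ring_1 set \<Rightarrow> nat \<Rightarrow> (nat \<Rightarrow> 'a) \<Rightarrow> 'a rel \<Rightarrow> 'a \<Rightarrow> (nat \<Rightarrow> nat)" where
  "lexp R n x ord f \<equiv> exp_of n x (lm R n x ord f)"

definition monomial_order :: "'a::ring_1 set \<Rightarrow> nat \<Rightarrow> (nat \<Rightarrow> 'a) \<Rightarrow> 'a rel \<Rightarrow> bool" where
  "monomial_order R n x ord \<longleftrightarrow> linear_order_on (Mon n x) ord \<and>
     (\<forall>\<alpha>\<in>expo n. \<forall>\<beta>\<in>expo n. \<forall>\<gamma>\<in>expo n. \<forall>\<mu>\<in>expo n.
        mon_ge ord (mon n x \<beta>) (mon n x \<alpha>) \<longrightarrow>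
        mon_ge ord (lm R n x ord (mon n x \<gamma> * mon n x \<beta> * mon n x \<mu>))
                   (lm R n x ord (mon n x \<gamma> * mon n x \<alpha> * mon n x \<mu>))) \<and>
     (\<forall>\<alpha>\<in>expo n. mon_ge ord (mon n x \<alpha>) 1) \<and>
     (\<forall>\<alpha>\<in>expo n. \<forall>\<beta>\<in>expo n.
        total_deg n \<beta> > total_deg n \<alpha> \<longrightarrow> mon_ge ord (mon n x \<beta>) (mon n x \<alpha>))"

definition red_step ::
    "'a::ring_1 set \<Rightarrow> nat \<Rightarrow> (nat \<Rightarrow> 'a) \<Rightarrow> 'a rel \<Rightarrow> 'a set \<Rightarrow> 'a \<Rightarrow> 'a \<Rightarrow> bool" where
  "red_step R n x ord F f h \<longleftrightarrow> (f = 0 \<and> h = 0) \<or>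
     (f \<noteq> 0 \<and> (\<exists>t::nat. \<exists>g r \<alpha>.
        (\<forall>i<t. g i \<in> F \<and> r i \<in> R \<and> \<alpha> i \<in> expo n \<and>
               \<alpha> i + lexp R n x ord (g i) = lexp R n x ord f) \<and>
        lc R n x ord f =
          (\<Sum>i<t. r i * sigma_pow R n x (\<alpha> i) (lc R n x ord (g i)) *
                   mult_coeff R n x (\<alpha> i) (lexp R n x ord (g i))) \<and>
        h = f - (\<Sum>i<t. r i * mon n x (\<alpha> i) * g i)))"

definition reduces_to ::
    "'a::ring_1 set \<Rightarrow> nat \<Rightarrow> (nat \<Rightarrow> 'a) \<Rightarrow> 'a rel \<Rightarrow> 'a set \<Rightarrow> 'a \<Rightarrow> 'a \<Rightarrow> bool" where
  "reduces_to R n x ord F = (red_step R n x ord F)\<^sup>+\<^sup>+"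

definition reducible ::
    "'a::ring_1 set \<Rightarrow> nat \<Rightarrow> (nat \<Rightarrow> 'a) \<Rightarrow> 'a rel \<Rightarrow> 'a set \<Rightarrow> 'a \<Rightarrow> bool" where
  "reducible R n x ord F f \<longleftrightarrow> f \<noteq> 0 \<and> (\<exists>h. red_step R n x ord F f h)"

definition groebner_basis ::
    "'a::ring_1 set \<Rightarrow> nat \<Rightarrow> (nat \<Rightarrow> 'a) \<Rightarrow> 'a rel \<Rightarrow> 'a set \<Rightarrow> 'a set \<Rightarrow> bool" where
  "groebner_basis R n x ord I G \<longleftrightarrow>
     (if I = {0} then G = {0}
      else G \<noteq> {} \<and> finite G \<and> G \<subseteq> I - {0} \<and> (\<forall>f\<in>I - {0}. reducible R n x ord G f))"


section \<open>The syzygy modules of the leading coefficients\<close>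

text \<open>
  \<open>lcm_exp\<close> is the exponent of the least common multiple of the leading monomials of a finite
  non-empty set \<open>F\<close>; for \<open>g \<in> F\<close>, \<open>cofactor_exp\<close> is the \<open>\<gamma>\<close> with
  \<open>\<gamma> + lexp R n x ord g = lcm_exp R n x ord F\<close>.
\<close>

definition lcm_exp ::
    "'a::ring_1 set \<Rightarrow> nat \<Rightarrow> (nat \<Rightarrow> 'a) \<Rightarrow> 'a rel \<Rightarrow> 'a set \<Rightarrow> (nat \<Rightarrow> nat)" where
  "lcm_exp R n x ord F = (\<lambda>i. Max ((\<lambda>g. lexp R n x ord g i) ` F))"

definition cofactor_exp ::
    "'a::ring_1 set \<Rightarrow> nat \<Rightarrow> (nat \<Rightarrow> 'a) \<Rightarrow> 'a rel \<Rightarrow> 'a set \<Rightarrow> 'a \<Rightarrow> (nat \<Rightarrow> nat)" where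
  "cofactor_exp R n x ord F g = (\<lambda>i. lcm_exp R n x ord F i - lexp R n x ord g i)"

text \<open>Tuples \<open>(b\<^sub>1, \<dots>, b\<^sub>s)\<close> for \<open>F = {g\<^sub>1, \<dots>, g\<^sub>s}\<close> are indexed by the elements of \<open>F\<close>.\<close>

definition lc_syz ::
    "'a::ring_1 set \<Rightarrow> nat \<Rightarrow> (nat \<Rightarrow> 'a) \<Rightarrow> 'a rel \<Rightarrow> 'a set \<Rightarrow> ('a \<Rightarrow> 'a) set" where
  "lc_syz R n x ord F = Syz R F
     (\<lambda>g. sigma_pow R n x (cofactor_exp R n x ord F g) (lc R n x ord g) *
          mult_coeff R n x (cofactor_exp R n x ord F g) (lexp R n x ord g))"

end

theory Submission
  imports Defs "HOL-Library.Multiset"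
begin

text \<open>
  The theorem is Buchberger's criterion, in the form in which the usual \<open>S\<close>-polynomials of pairs
  are replaced by one combination \<open>\<Sum>\<^sub>g b\<^sub>g x\<^bsup>\<gamma>\<^sub>g\<^esup> g\<close> for each generator \<open>b\<close> of the syzygies of the
  leading coefficients of each subset of \<open>G\<close>; larger subsets matter because \<open>R\<close> need not be
  a field.

  Three facts about the extension carry the argument.  Modulo monomials of smaller total degree,
  letters commute up to units of \<open>R\<close>, so every product of monomials has the form
  \<open>x\<^sup>\<alpha> x\<^sup>\<beta> = c\<^sub>\<alpha>\<^sub>\<beta> x\<^bsup>\<alpha>+\<beta>\<^esup> + \<dots>\<close> with an invertible coefficient (\<open>mult_coeff\<close>).  Comparing the two ways
  to bracket \<open>x\<^sup>\<theta> x\<^sup>\<gamma> (r x\<^sup>\<beta>)\<close> gives the cocycle identity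
  \<open>c\<^sub>\<theta>\<^sub>\<gamma> \<sigma>\<^bsup>\<theta>+\<gamma>\<^esup>(r) c\<^bsub>\<theta>+\<gamma>,\<beta>\<^esub> = \<sigma>\<^sup>\<theta>(\<sigma>\<^sup>\<gamma>(r) c\<^sub>\<gamma>\<^sub>\<beta>) c\<^bsub>\<theta>,\<gamma>+\<beta>\<^esub>\<close> (\<open>mult_coeff_assoc\<close>).  Finally, a monomial order
  that refines the total degree has finite initial segments, so it is the pullback of the order of
  the natural numbers along an injective rank function \<open>rk\<close>, and inductions along the monomial order run over ranks.

  If \<open>G\<close> is a Groebner basis, each reduction step lowers the rank of the leading exponent and stays
  in \<open>I\<close>; since no non-zero element of \<open>I\<close> is reduced, every element of \<open>I\<close>, in particular
  every syzygy combination, reaches \<open>0\<close> (\<open>reduces_to_zero\<close>).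

  Conversely, let \<open>filt G k\<close> be the \<open>R\<close>-span of the products \<open>x\<^sup>\<kappa> g\<close> whose leading exponent has rank
  below \<open>k\<close>.  These spans exhaust \<open>I\<close>, and a non-zero element \<open>f\<close> of \<open>I\<close> is shown to be reducible by
  induction on \<open>k\<close> with \<open>f \<in> filt G k\<close>.  Let \<open>\<delta>\<close> be the exponent of the top rank.  If the
  coefficient of \<open>f\<close> at \<open>\<delta>\<close> is non-zero, then the summands with leading exponent \<open>\<delta>\<close> express
  \<open>lc(f)\<close> in exactly the way a reduction step asks for.  If it is zero, the coefficients of these
  summands form a syzygy.  The cocycle identity and the bijectivity of \<open>\<sigma>\<^sup>\<theta>\<close> pull it back to a
  syzygy at the least common multiple \<open>\<zeta>\<close> of the leading monomials, where \<open>\<delta> = \<theta> + \<zeta>\<close>; there it is a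
  combination of the generators \<open>b\<close>.  A syzygy combination of the \<open>x\<^bsup>\<gamma>\<^sub>g\<^esup> g\<close> that reduces to \<open>0\<close> lies in
  \<open>filt G (rk \<zeta>)\<close>, the reduction steps themselves being the witness, so after multiplication by
  \<open>x\<^sup>\<theta>\<close> the top summands of \<open>f\<close> can be rewritten with smaller leading exponents (\<open>lift_syzygy\<close>),
  and \<open>f\<close> lies in an earlier member of the filtration.
\<close>

section \<open>Spans over a subring\<close>

text \<open>
  The left \<open>R\<close>-submodule spanned by \<open>S\<close>, generated one summand at a time, so that properties
  of linear combinations follow by rule induction, without indexed families of coefficients.
\<close>

inductive_set lspan :: "'a::ring_1 set \<Rightarrow> 'a set \<Rightarrow> 'a set" for R S where
  zero: "0 \<in> lspan R S"
| step: "r \<in> R \<Longrightarrow> s \<in> S \<Longrightarrow> f \<in> lspan R S \<Longrightarrow> r * s + f \<in> lspan R S"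

lemma lspan_add:
  assumes "f \<in> lspan R S" "g \<in> lspan R S"
  shows "f + g \<in> lspan R S"
  using assms(1) by induction (auto simp: add.assoc assms(2) intro: lspan.step)

lemma lspan_sum:
  assumes "\<And>i. i \<in> A \<Longrightarrow> f i \<in> lspan R S"
  shows "sum f A \<in> lspan R S"
  using assms by (induction A rule: infinite_finite_induct) (auto intro: lspan_add lspan.zero)

lemma lspan_mult_right:
  assumes "f \<in> lspan R S" "\<And>r s. r \<in> R \<Longrightarrow> s \<in> S \<Longrightarrow> r * (s * h) \<in> lspan R T"
  shows "f * h \<in> lspan R T"
  using assms(1) by induction (auto simp: algebra_simps lspan.zero intro!: lspan_add assms(2))

lemma lspan_mult_left:
  assumes "f \<in> lspan R S" "\<And>r s. r \<in> R \<Longrightarrow> s \<in> S \<Longrightarrow> h * (r * s) \<in> lspan R T"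
  shows "h * f \<in> lspan R T"
  using assms(1) by induction (auto simp: distrib_left lspan.zero intro!: lspan_add assms(2))

lemma lspan_mono:
  assumes "f \<in> lspan R S" "S \<subseteq> T"
  shows "f \<in> lspan R T"
  using assms(1) by induction (use assms(2) in \<open>auto intro: lspan.intros\<close>)

lemma left_ideal_sum:
  assumes "left_ideal UNIV I" "\<And>i. i \<in> A \<Longrightarrow> g i \<in> I"
  shows "(\<Sum>i\<in>A. a i * g i) \<in> I"
  using assms(2)
  by (induction A rule: infinite_finite_induct) (use assms(1) in \<open>auto simp: left_ideal_def\<close>)

locale subring =
  fixes R :: "'a::ring_1 set"
  assumes subring: "is_subring R"
begin

lemma R_one [simp]: "1 \<in> R" and R_diff: "a \<in> R \<Longrightarrow> b \<in> R \<Longrightarrow> a - b \<in> R"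
  and R_mult [simp]: "a \<in> R \<Longrightarrow> b \<in> R \<Longrightarrow> a * b \<in> R"
  using subring by (auto simp: is_subring_def)

lemma R_zero [simp]: "0 \<in> R"
  using R_diff[of 1 1] by simp

lemma R_minus [simp]: "a \<in> R \<Longrightarrow> - a \<in> R"
  using R_diff[of 0 a] by simp

lemma R_add [simp]: "a \<in> R \<Longrightarrow> b \<in> R \<Longrightarrow> a + b \<in> R"
  using R_diff[of a "- b"] by simp

lemma R_sum: "(\<And>i. i \<in> A \<Longrightarrow> f i \<in> R) \<Longrightarrow> sum f A \<in> R"
  by (induction A rule: infinite_finite_induct) auto

lemma lspan_base: "s \<in> S \<Longrightarrow> s \<in> lspan R S"
  using lspan.step[OF R_one _ lspan.zero] by simp

lemma lspan_scale:
  assumes "f \<in> lspan R S" "r \<in> R"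
  shows "r * f \<in> lspan R S"
  using assms(1)
proof induction
  case (step q s f)
  then have "(r * q) * s + r * f \<in> lspan R S" using assms(2) by (auto intro: lspan.step)
  then show ?case by (simp add: algebra_simps)
qed (simp add: lspan.zero)

lemma lspan_diff: "f \<in> lspan R S \<Longrightarrow> g \<in> lspan R S \<Longrightarrow> f - g \<in> lspan R S"
  using lspan_add[OF _ lspan_scale[of g S "- 1"], of f] by simp

lemma lspan_subset:
  assumes "f \<in> lspan R S" "\<And>s. s \<in> S \<Longrightarrow> s \<in> lspan R T"
  shows "f \<in> lspan R T"
  using assms(1) by induction (auto intro: lspan_add lspan_scale assms(2) lspan.zero)

definition unit :: "'a \<Rightarrow> bool" where
  "unit c \<longleftrightarrow> invertible_in R c"

lemma unit_in: "unit c \<Longrightarrow> c \<in> R"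
  by (simp add: unit_def invertible_in_def)

lemma unit_inverse:
  assumes "unit c"
  obtains d where "unit d" "c * d = 1" "d * c = 1"
  using assms by (auto simp: unit_def invertible_in_def)

lemma unit_one: "unit 1"
  by (auto simp: unit_def invertible_in_def intro!: bexI[of _ 1])

lemma unit_mult:
  assumes "unit c" "unit d"
  shows "unit (c * d)"
proof -
  obtain c' d' where "unit c'" "c * c' = 1" "c' * c = 1" "unit d'" "d * d' = 1" "d' * d = 1"
    using assms by (metis unit_inverse)
  moreover from this have "c * d * (d' * c') = 1" "d' * c' * (c * d) = 1"
    by (metis mult.assoc mult_1_right)+
  ultimately show ?thesis
    using assms unfolding unit_def invertible_in_def by (metis R_mult)
qed

lemma unit_nonzero: "unit c \<Longrightarrow> c \<noteq> 0"
  by (auto simp: unit_def invertible_in_def)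

end

section \<open>Words and exponent vectors\<close>

definition word :: "(nat \<Rightarrow> 'a::ring_1) \<Rightarrow> nat list \<Rightarrow> 'a" where
  "word x w = prod_list (map x w)"

text \<open>
  The word whose product is the standard monomial \<open>x\<^sup>\<alpha>\<close>.  Words allow products of monomials to be
  compared letter by letter before they are brought into standard form.
\<close>

definition sorted_word :: "nat \<Rightarrow> (nat \<Rightarrow> nat) \<Rightarrow> nat list" where
  "sorted_word n \<alpha> = concat (map (\<lambda>i. replicate (\<alpha> i) i) [0..<n])"

lemma word_Nil [simp]: "word x [] = 1"
  and word_Cons [simp]: "word x (i # w) = x i * word x w"
  and word_append [simp]: "word x (u @ v) = word x u * word x v"
  by (simp_all add: word_def)

lemma word_sorted_word: "word x (sorted_word n \<alpha>) = mon n x \<alpha>"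
proof -
  have rep: "word x (replicate k i) = x i ^ k" for k i
    by (induction k) simp_all
  have "word x (concat (map (\<lambda>i. replicate (\<alpha> i) i) l)) = prod_list (map (\<lambda>i. x i ^ \<alpha> i) l)" for l
    by (induction l) (simp_all add: rep)
  then show ?thesis by (simp add: sorted_word_def mon_def)
qed

lemma set_sorted_word: "set (sorted_word n \<alpha>) \<subseteq> {..<n}"
  by (auto simp: sorted_word_def)

lemma length_sorted_word: "length (sorted_word n \<alpha>) = total_deg n \<alpha>"
  by (induction n) (simp_all add: sorted_word_def total_deg_def)

lemma count_sorted_word: "count (mset (sorted_word n \<alpha>)) i = (if i < n then \<alpha> i else 0)"
  by (induction n) (auto simp: sorted_word_def less_Suc_eq)

lemma expo_add [simp]: "\<alpha> \<in> expo n \<Longrightarrow> \<beta> \<in> expo n \<Longrightarrow> \<alpha> + \<beta> \<in> expo n"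
  by (simp add: expo_def)

lemma total_deg_add: "total_deg n (\<alpha> + \<beta>) = total_deg n \<alpha> + total_deg n \<beta>"
  by (simp add: total_deg_def sum.distrib)

lemma mset_sorted_word_add:
  "mset (sorted_word n (\<alpha> + \<beta>)) = mset (sorted_word n \<alpha> @ sorted_word n \<beta>)"
  by (rule multiset_eqI) (simp add: count_sorted_word)

lemma mset_sorted_word_count:
  "set w \<subseteq> {..<n} \<Longrightarrow> mset (sorted_word n (count (mset w))) = mset w"
  by (rule multiset_eqI) (auto simp: count_sorted_word not_in_iff)

lemma expo_count: "set w \<subseteq> {..<n} \<Longrightarrow> count (mset w) \<in> expo n"
  by (auto simp: expo_def count_eq_zero_iff)

lemma finite_expo_bounded: "finite {\<alpha> \<in> expo n. total_deg n \<alpha> \<le> d}"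
proof (rule finite_subset)
  show "{\<alpha> \<in> expo n. total_deg n \<alpha> \<le> d}
    \<subseteq> {\<alpha>. \<forall>i. (i \<in> {..<n} \<longrightarrow> \<alpha> i \<in> {..d}) \<and> (i \<notin> {..<n} \<longrightarrow> \<alpha> i = 0)}"
    by (auto simp: expo_def total_deg_def intro: order_trans[OF member_le_sum[of _ "{..<n}"]])
  show "finite {\<alpha>::nat \<Rightarrow> nat. \<forall>i. (i \<in> {..<n} \<longrightarrow> \<alpha> i \<in> {..d}) \<and> (i \<notin> {..<n} \<longrightarrow> \<alpha> i = 0)}"
    by (rule finite_set_of_finite_funs) auto
qed

section \<open>Coefficients in a skew PBW extension\<close>

locale skew_PBW_extension =
  fixes R :: "'a::ring_1 set" and n :: nat and x :: "nat \<Rightarrow> 'a"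
  assumes bijective: "bijective_skew_PBW R n x"
begin

lemma skew: "skew_PBW R n x"
  using bijective by (simp add: bijective_skew_PBW_def)

sublocale subring R
  using skew by unfold_locales (simp add: skew_PBW_def)

abbreviation "cf \<equiv> coef R n x"
abbreviation "m \<equiv> mon n x"
abbreviation "td \<equiv> total_deg n"
abbreviation "\<sigma> \<equiv> sigma R x"
abbreviation "sp \<equiv> sigma_pow R n x"
abbreviation "mc \<equiv> mult_coeff R n x"

lemma represents_unique: "\<exists>!c. represents R n x c f"
  using skew by (simp add: skew_PBW_def)

lemma represents_coef: "represents R n x (cf f) f"
  unfolding coef_def by (rule theI'[OF represents_unique])

lemma coef_eqI: "represents R n x c f \<Longrightarrow> cf f = c"
  using represents_unique represents_coef by blast

lemma coef_in [simp]: "cf f \<alpha> \<in> R" and finite_supp: "finite {\<alpha>. cf f \<alpha> \<noteq> 0}"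
  and supp_expo: "cf f \<alpha> \<noteq> 0 \<Longrightarrow> \<alpha> \<in> expo n"
  and coef_expand: "f = (\<Sum>\<alpha> | cf f \<alpha> \<noteq> 0. cf f \<alpha> * m \<alpha>)"
  using represents_coef[of f] by (auto simp: represents_def)

lemma coef_eq_sum:
  assumes "finite S" "S \<subseteq> expo n" "\<And>\<alpha>. \<alpha> \<in> S \<Longrightarrow> c \<alpha> \<in> R" "f = (\<Sum>\<alpha>\<in>S. c \<alpha> * m \<alpha>)"
  shows "cf f = (\<lambda>\<alpha>. if \<alpha> \<in> S then c \<alpha> else 0)"
proof (rule coef_eqI)
  let ?c = "\<lambda>\<alpha>. if \<alpha> \<in> S then c \<alpha> else 0"
  have "(\<Sum>\<alpha> | ?c \<alpha> \<noteq> 0. ?c \<alpha> * m \<alpha>) = (\<Sum>\<alpha>\<in>S. c \<alpha> * m \<alpha>)"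
    by (rule sum.mono_neutral_cong_left) (use assms(1) in auto)
  then show "represents R n x ?c f"
    unfolding represents_def using assms by (auto intro: rev_finite_subset[OF assms(1)] split: if_splits)
qed

lemma coef_expand_on:
  assumes "finite S" "{\<alpha>. cf f \<alpha> \<noteq> 0} \<subseteq> S"
  shows "f = (\<Sum>\<alpha>\<in>S. cf f \<alpha> * m \<alpha>)"
  by (subst coef_expand) (rule sum.mono_neutral_left, use assms in auto)

lemma coef_add: "cf (f + g) \<alpha> = cf f \<alpha> + cf g \<alpha>"
proof -
  let ?S = "{\<alpha>. cf f \<alpha> \<noteq> 0} \<union> {\<alpha>. cf g \<alpha> \<noteq> 0}"
  have fin: "finite ?S" by (simp add: finite_supp)
  have "f + g = (\<Sum>\<alpha>\<in>?S. cf f \<alpha> * m \<alpha>) + (\<Sum>\<alpha>\<in>?S. cf g \<alpha> * m \<alpha>)"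
    by (intro arg_cong2[of _ _ _ _ "(+)"] coef_expand_on fin) auto
  also have "\<dots> = (\<Sum>\<alpha>\<in>?S. (cf f \<alpha> + cf g \<alpha>) * m \<alpha>)"
    by (simp add: sum.distrib distrib_right)
  finally have "cf (f + g) = (\<lambda>\<alpha>. if \<alpha> \<in> ?S then cf f \<alpha> + cf g \<alpha> else 0)"
    by (intro coef_eq_sum fin) (auto dest: supp_expo)
  then show ?thesis by auto
qed

lemma coef_scale:
  assumes "r \<in> R"
  shows "cf (r * f) \<alpha> = r * cf f \<alpha>"
proof -
  let ?S = "{\<alpha>. cf f \<alpha> \<noteq> 0}"
  have "r * f = (\<Sum>\<alpha>\<in>?S. (r * cf f \<alpha>) * m \<alpha>)"
    by (subst coef_expand[of f]) (simp add: sum_distrib_left mult.assoc)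
  then have "cf (r * f) = (\<lambda>\<alpha>. if \<alpha> \<in> ?S then r * cf f \<alpha> else 0)"
    by (intro coef_eq_sum) (auto simp: finite_supp assms dest: supp_expo)
  then show ?thesis by auto
qed

lemma coef_mon: "\<alpha> \<in> expo n \<Longrightarrow> cf (m \<alpha>) \<beta> = (if \<beta> = \<alpha> then 1 else 0)"
  using coef_eq_sum[of "{\<alpha>}" "\<lambda>_. 1" "m \<alpha>"] by auto

lemma coef_zero [simp]: "cf 0 \<alpha> = 0"
  using coef_add[of 0 0 \<alpha>] by simp

lemma coef_minus: "cf (- f) \<alpha> = - cf f \<alpha>"
  using coef_scale[of "- 1" f] by simp

lemma coef_diff: "cf (f - g) \<alpha> = cf f \<alpha> - cf g \<alpha>"
  using coef_add[of f "- g"] by (simp add: coef_minus)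

lemma coef_sum: "cf (sum f A) \<alpha> = (\<Sum>i\<in>A. cf (f i) \<alpha>)"
  by (induction A rule: infinite_finite_induct) (simp_all add: coef_add)

lemma coef_term: "r \<in> R \<Longrightarrow> \<alpha> \<in> expo n \<Longrightarrow> cf (r * m \<alpha>) \<beta> = (if \<beta> = \<alpha> then r else 0)"
  by (simp add: coef_scale coef_mon)

lemma coef_eq_0_imp: "(\<And>\<alpha>. cf f \<alpha> = 0) \<Longrightarrow> f = 0"
  using coef_expand[of f] by simp

lemma mon_inj: "\<alpha> \<in> expo n \<Longrightarrow> \<beta> \<in> expo n \<Longrightarrow> m \<alpha> = m \<beta> \<longleftrightarrow> \<alpha> = \<beta>"
  by (metis coef_mon zero_neq_one)

lemma mon_nonzero: "\<alpha> \<in> expo n \<Longrightarrow> m \<alpha> \<noteq> 0"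
  by (metis coef_mon coef_zero zero_neq_one)

lemma exp_of_mon: "\<alpha> \<in> expo n \<Longrightarrow> exp_of n x (m \<alpha>) = \<alpha>"
  unfolding exp_of_def by (rule the_equality) (auto simp: mon_inj)

text \<open>
  Translates between combinations of monomials, on which one can do induction, and conditions on the
  support, which are decided by the uniqueness of coefficients.
\<close>

lemma lspan_mon_iff:
  assumes "T \<subseteq> expo n"
  shows "f \<in> lspan R (m ` T) \<longleftrightarrow> (\<forall>\<alpha>. cf f \<alpha> \<noteq> 0 \<longrightarrow> \<alpha> \<in> T)"
proof
  assume "f \<in> lspan R (m ` T)"
  then show "\<forall>\<alpha>. cf f \<alpha> \<noteq> 0 \<longrightarrow> \<alpha> \<in> T"
  proof induction
    case (step r s f)
    then obtain \<beta> where "\<beta> \<in> T" "s = m \<beta>" by auto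
    with step assms show ?case by (auto simp: coef_add coef_term subset_iff split: if_splits)
  qed simp
next
  assume "\<forall>\<alpha>. cf f \<alpha> \<noteq> 0 \<longrightarrow> \<alpha> \<in> T"
  then show "f \<in> lspan R (m ` T)"
    by (subst coef_expand, intro lspan_sum lspan_scale lspan_base) auto
qed

section \<open>Commutation up to lower degree\<close>

text \<open>
  Words with ascending letters are exactly the basis monomials, so the products \<open>x\<^sub>i\<close> and
  \<open>x\<^sub>i x\<^sub>j\<close> with \<open>i < j\<close> that occur in the axioms can be told apart by their coefficients.
\<close>

lemma word_ascending:
  assumes "sorted w" "set w \<subseteq> {..<n}"
  shows "word x w = m (count (mset w))"
proof -
  have "sorted (concat (map (\<lambda>i. replicate (\<alpha> i) i) [0..<k]))" for \<alpha> :: "nat \<Rightarrow> nat" and k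
    by (induction k) (auto simp: sorted_append)
  then have "sorted (sorted_word n (count (mset w)))"
    by (simp add: sorted_word_def)
  then have "sorted_word n (count (mset w)) = w"
    using assms by (metis properties_for_sort mset_sorted_word_count)
  then show ?thesis by (metis word_sorted_word)
qed

lemma coef_word_ascending:
  assumes "sorted w" "set w \<subseteq> {..<n}" "sorted v" "set v \<subseteq> {..<n}" "r \<in> R"
  shows "cf (r * word x w) (count (mset v)) = (if v = w then r else 0)"
proof -
  have "count (mset v) = count (mset w) \<longleftrightarrow> v = w"
    using assms by (metis multiset_eqI properties_for_sort)
  then show ?thesis
    using assms by (simp add: word_ascending coef_term expo_count)
qed

lemma coef_R:
  assumes "r \<in> R" "sorted v" "set v \<subseteq> {..<n}" "v \<noteq> []"
  shows "cf r (count (mset v)) = 0"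
  using coef_word_ascending[of "[]" v r] assms by simp

text \<open>
  Uniqueness rests on the independence of \<open>1\<close> and \<open>x\<^sub>i\<close>: two candidates \<open>s\<close>, \<open>t\<close> would put
  \<open>(t - s) x\<^sub>i\<close> into \<open>R\<close>.  It makes \<open>sigma\<close> an additive and multiplicative map below.
\<close>

lemma sigma_ex1:
  assumes "i < n" "r \<in> R"
  shows "\<exists>!s. s \<in> R \<and> x i * r - s * x i \<in> R"
proof (rule ex_ex1I)
  show "\<exists>s. s \<in> R \<and> x i * r - s * x i \<in> R"
  proof (cases "r = 0")
    case False
    then have "\<exists>c\<in>R - {0}. x i * r - c * x i \<in> R"
      using skew assms unfolding skew_PBW_def by blast
    then show ?thesis by blast
  qed (auto intro!: exI[of _ 0])
next
  fix s t
  assume s: "s \<in> R \<and> x i * r - s * x i \<in> R" and t: "t \<in> R \<and> x i * r - t * x i \<in> R"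
  then have "(x i * r - s * x i) - (x i * r - t * x i) \<in> R" by (blast intro: R_diff)
  then have "(t - s) * x i \<in> R" by (simp add: algebra_simps)
  then have "cf ((t - s) * word x [i]) (count (mset [i])) = 0"
    by (intro coef_R) (use assms in auto)
  then show "s = t"
    using coef_word_ascending[of "[i]" "[i]" "t - s"] s t assms R_diff by auto
qed

lemma sigma_in: "i < n \<Longrightarrow> r \<in> R \<Longrightarrow> \<sigma> i r \<in> R"
  and sigma_rem: "i < n \<Longrightarrow> r \<in> R \<Longrightarrow> x i * r - \<sigma> i r * x i \<in> R"
  using theI'[OF sigma_ex1] by (auto simp: sigma_def)

lemma sigma_eqI: "i < n \<Longrightarrow> r \<in> R \<Longrightarrow> s \<in> R \<Longrightarrow> x i * r - s * x i \<in> R \<Longrightarrow> \<sigma> i r = s"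
  using sigma_ex1 sigma_in sigma_rem by blast

lemma sigma_add:
  assumes "i < n" "r \<in> R" "s \<in> R"
  shows "\<sigma> i (r + s) = \<sigma> i r + \<sigma> i s"
proof (rule sigma_eqI)
  have "(x i * r - \<sigma> i r * x i) + (x i * s - \<sigma> i s * x i) \<in> R"
    using assms by (blast intro: R_add sigma_rem)
  then show "x i * (r + s) - (\<sigma> i r + \<sigma> i s) * x i \<in> R"
    by (simp add: algebra_simps)
qed (use assms sigma_in in auto)

lemma sigma_mult:
  assumes "i < n" "r \<in> R" "s \<in> R"
  shows "\<sigma> i (r * s) = \<sigma> i r * \<sigma> i s"
proof (rule sigma_eqI)
  have "(x i * r - \<sigma> i r * x i) * s + \<sigma> i r * (x i * s - \<sigma> i s * x i) \<in> R"
    using assms by (blast intro: R_add R_mult sigma_rem sigma_in)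
  then show "x i * (r * s) - (\<sigma> i r * \<sigma> i s) * x i \<in> R"
    by (simp add: algebra_simps)
qed (use assms sigma_in in auto)

lemma sigma_one: "i < n \<Longrightarrow> \<sigma> i 1 = 1"
  by (rule sigma_eqI) auto

lemma sigma_bij: "i < n \<Longrightarrow> bij_betw (\<sigma> i) R R"
  using bijective by (simp add: bijective_skew_PBW_def)

lemma coef_lin_part:
  assumes "f \<in> lin_part R n x" "sorted v" "set v \<subseteq> {..<n}" "length v = 2"
  shows "cf f (count (mset v)) = 0"
proof -
  obtain s r where f: "s \<in> R" "r \<in> {..<n} \<rightarrow> R" "f = s + (\<Sum>k<n. r k * x k)"
    using assms(1) by (auto simp: lin_part_def)
  have "cf (r k * x k) (count (mset v)) = 0" if "k < n" for k
    using coef_word_ascending[of "[k]" v "r k"] that assms funcset_mem[OF f(2), of k] by auto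
  moreover have "v \<noteq> []" using assms(4) by auto
  ultimately show ?thesis
    using assms f by (simp add: coef_add coef_sum coef_R)
qed

lemma lin_part_diff:
  assumes "f \<in> lin_part R n x" "g \<in> lin_part R n x"
  shows "f - g \<in> lin_part R n x"
proof -
  obtain s r s' r' where *: "s \<in> R" "r \<in> {..<n} \<rightarrow> R" "f = s + (\<Sum>k<n. r k * x k)"
    "s' \<in> R" "r' \<in> {..<n} \<rightarrow> R" "g = s' + (\<Sum>k<n. r' k * x k)"
    using assms by (auto simp: lin_part_def)
  have "f - g = (s - s') + (\<Sum>k<n. (r k - r' k) * x k)"
    by (simp add: * left_diff_distrib sum_subtractf)
  moreover have "(\<lambda>k. r k - r' k) \<in> {..<n} \<rightarrow> R" "s - s' \<in> R"
    using * by (auto intro!: R_diff)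
  ultimately show ?thesis
    unfolding lin_part_def by (intro CollectI exI[of _ "s - s'"] exI[of _ "\<lambda>k. r k - r' k"] conjI)
qed

text \<open>
  The commutation coefficient is a definite description, and its invertibility is only known once
  the description is known to denote.  Uniqueness holds because \<open>x\<^sub>i x\<^sub>j\<close> is a basis monomial
  of degree two when \<open>i < j\<close>.
\<close>

lemma swap_vars:
  assumes "i < j" "j < n"
  shows "\<exists>c. unit c \<and> x j * x i - c * x i * x j \<in> lin_part R n x"
proof -
  have "\<exists>!c. c \<in> R - {0} \<and> x j * x i - c * x i * x j \<in> lin_part R n x"
  proof (rule ex_ex1I)
    show "\<exists>c. c \<in> R - {0} \<and> x j * x i - c * x i * x j \<in> lin_part R n x"
      using skew assms unfolding skew_PBW_def by (meson order.strict_trans)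
  next
    fix c d
    assume c: "c \<in> R - {0} \<and> x j * x i - c * x i * x j \<in> lin_part R n x"
      and d: "d \<in> R - {0} \<and> x j * x i - d * x i * x j \<in> lin_part R n x"
    then have "(x j * x i - c * x i * x j) - (x j * x i - d * x i * x j) \<in> lin_part R n x"
      by (blast intro: lin_part_diff)
    then have "(d - c) * word x [i, j] \<in> lin_part R n x"
      by (simp add: algebra_simps)
    then have "cf ((d - c) * word x [i, j]) (count (mset [i, j])) = 0"
      by (rule coef_lin_part) (use assms in auto)
    then show "c = d"
      using coef_word_ascending[of "[i, j]" "[i, j]" "d - c"] c d assms R_diff by auto
  qed
  from theI'[OF this] show ?thesis
    using bijective assms unfolding unit_def bijective_skew_PBW_def comm_coeff_def
    by blast
qed


text \<open>
  The elements of degree less than \<open>d\<close>.  The definition by words rather than by monomials makes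
  closure under multiplication immediate; lemma \<open>low_lspan_mon\<close> shows that monomials span the same.
\<close>

definition low :: "nat \<Rightarrow> 'a set" where
  "low d = lspan R {word x w | w. set w \<subseteq> {..<n} \<and> length w < d}"

lemma low_word: "set w \<subseteq> {..<n} \<Longrightarrow> length w < d \<Longrightarrow> word x w \<in> low d"
  unfolding low_def by (rule lspan_base) auto

lemma low_add: "f \<in> low d \<Longrightarrow> g \<in> low d \<Longrightarrow> f + g \<in> low d"
  and low_diff: "f \<in> low d \<Longrightarrow> g \<in> low d \<Longrightarrow> f - g \<in> low d"
  and low_scale: "f \<in> low d \<Longrightarrow> r \<in> R \<Longrightarrow> r * f \<in> low d"
  and low_zero: "0 \<in> low d"
  by (simp_all add: low_def lspan_add lspan_diff lspan_scale lspan.zero)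

lemma low_mono: "f \<in> low d \<Longrightarrow> d \<le> e \<Longrightarrow> f \<in> low e"
  unfolding low_def by (erule lspan_mono) auto

text \<open>
  Moving \<open>x\<^sub>i\<close> past a coefficient costs a summand without \<open>x\<^sub>i\<close>, hence of smaller degree.
\<close>

lemma low_lmult_var:
  assumes "f \<in> low d" "i < n"
  shows "x i * f \<in> low (Suc d)"
  using assms(1) unfolding low_def
proof (rule lspan_mult_left, fold low_def)
  fix r s
  assume r: "r \<in> R" and "s \<in> {word x w |w. set w \<subseteq> {..<n} \<and> length w < d}"
  then obtain w where w: "s = word x w" "set w \<subseteq> {..<n}" "length w < d" by auto
  have "x i * (r * s) = \<sigma> i r * word x (i # w) + (x i * r - \<sigma> i r * x i) * word x w"
    by (simp add: w algebra_simps)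
  also have "\<dots> \<in> low (Suc d)"
    using w r assms(2) by (intro low_add low_scale low_word sigma_in sigma_rem) auto
  finally show "x i * (r * s) \<in> low (Suc d)" .
qed

lemma low_lmult_word:
  "f \<in> low d \<Longrightarrow> set w \<subseteq> {..<n} \<Longrightarrow> word x w * f \<in> low (length w + d)"
  by (induction w) (auto simp: mult.assoc intro: low_lmult_var)

lemma low_rmult_word:
  assumes "f \<in> low d" "set v \<subseteq> {..<n}"
  shows "f * word x v \<in> low (d + length v)"
  using assms(1) unfolding low_def
proof (rule lspan_mult_right, fold low_def)
  fix r s
  assume r: "r \<in> R" and "s \<in> {word x w |w. set w \<subseteq> {..<n} \<and> length w < d}"
  then obtain w where w: "s = word x w" "set w \<subseteq> {..<n}" "length w < d" by auto
  have "word x (w @ v) \<in> low (d + length v)"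
    using w assms(2) by (intro low_word) auto
  then show "r * (s * word x v) \<in> low (d + length v)"
    using r w by (simp add: low_scale)
qed

definition sigma_word :: "nat list \<Rightarrow> 'a \<Rightarrow> 'a" where
  "sigma_word w = foldr (\<lambda>i h. \<sigma> i \<circ> h) w id"

lemma sigma_word_Nil [simp]: "sigma_word [] = id"
  and sigma_word_Cons [simp]: "sigma_word (i # w) = \<sigma> i \<circ> sigma_word w"
  by (simp_all add: sigma_word_def)

lemma sigma_pow_word: "sp \<alpha> = sigma_word (sorted_word n \<alpha>)"
proof -
  have rep: "((\<lambda>h b. s (h b)) ^^ k) h = (\<lambda>b. (s ^^ k) (h b))"
    for k and s :: "'a \<Rightarrow> 'a" and h :: "'a \<Rightarrow> 'a"
    by (induction k) simp_all
  have "foldr (\<lambda>i h. \<sigma> i \<circ> h) (concat (map (\<lambda>i. replicate (\<alpha> i) i) l)) id =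
    foldr (\<lambda>i h. (\<sigma> i ^^ \<alpha> i) \<circ> h) l id" for l
    by (induction l) (simp_all add: rep comp_def)
  then show ?thesis
    by (simp add: sigma_pow_def sigma_word_def sorted_word_def)
qed

lemma sigma_word_in: "set w \<subseteq> {..<n} \<Longrightarrow> r \<in> R \<Longrightarrow> sigma_word w r \<in> R"
  by (induction w) (auto intro: sigma_in)

lemma sigma_word_rem:
  "set w \<subseteq> {..<n} \<Longrightarrow> r \<in> R \<Longrightarrow> word x w * r - sigma_word w r * word x w \<in> low (length w)"
proof (induction w)
  case (Cons i w)
  let ?s = "sigma_word w r"
  have "x i * (word x w * r - ?s * word x w) \<in> low (Suc (length w))"
    using Cons by (intro low_lmult_var) auto
  moreover have "(x i * ?s - \<sigma> i ?s * x i) * word x w \<in> low (Suc (length w))"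
    using Cons by (intro low_scale low_word sigma_rem sigma_word_in) auto
  ultimately have "x i * (word x w * r - ?s * word x w) + (x i * ?s - \<sigma> i ?s * x i) * word x w
    \<in> low (length (i # w))"
    by (simp add: low_add)
  then show ?case by (simp add: algebra_simps)
qed (simp add: low_zero)

lemma low_rmult_R:
  assumes "f \<in> low d" "r \<in> R"
  shows "f * r \<in> low d"
  using assms(1) unfolding low_def
proof (rule lspan_mult_right, fold low_def)
  fix q s
  assume q: "q \<in> R" and "s \<in> {word x w |w. set w \<subseteq> {..<n} \<and> length w < d}"
  then obtain w where w: "s = word x w" "set w \<subseteq> {..<n}" "length w < d" by auto
  have "s * r = (word x w * r - sigma_word w r * word x w) + sigma_word w r * word x w"
    by (simp add: w)
  also have "\<dots> \<in> low d"
    using w assms(2) low_mono[OF sigma_word_rem[of w r], of d]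
    by (intro low_add low_scale low_word sigma_word_in) auto
  finally show "q * (s * r) \<in> low d" using q by (rule low_scale)
qed

section \<open>Reordering the letters of a word\<close>

text \<open>
  Equality up to a unit and up to words of smaller length.  It is the relation under which letters
  commute; equal length is part of it so that the error term has the same meaning on both sides.
\<close>

definition similar :: "nat list \<Rightarrow> nat list \<Rightarrow> bool" where
  "similar u v \<longleftrightarrow> length u = length v \<and> set v \<subseteq> {..<n} \<and>
     (\<exists>c. unit c \<and> word x u - c * word x v \<in> low (length u))"

lemma similar_refl: "set u \<subseteq> {..<n} \<Longrightarrow> similar u u"
  unfolding similar_def by (auto intro!: exI[of _ 1] simp: unit_one low_zero)

lemma similar_sym:
  assumes "similar u v" "set u \<subseteq> {..<n}"
  shows "similar v u"
proof -
  obtain c where c: "unit c" "word x u - c * word x v \<in> low (length u)" "length u = length v"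
    using assms by (auto simp: similar_def)
  obtain d where d: "unit d" "d * c = 1" using c(1) by (metis unit_inverse)
  have "(- d) * (word x u - c * word x v) \<in> low (length v)"
    using c d by (intro low_scale) (auto simp: unit_in)
  moreover have "(- d) * (word x u - c * word x v) = word x v - d * word x u"
    by (simp add: right_diff_distrib flip: mult.assoc) (simp add: d)
  ultimately show ?thesis using assms c d by (auto simp: similar_def)
qed

lemma similar_trans:
  assumes "similar u v" "similar v w"
  shows "similar u w"
proof -
  obtain c where c: "unit c" "word x u - c * word x v \<in> low (length u)"
    using assms by (auto simp: similar_def)
  obtain d where d: "unit d" "word x v - d * word x w \<in> low (length u)"
    using assms by (auto simp: similar_def)
  have "(word x u - c * word x v) + c * (word x v - d * word x w) \<in> low (length u)"
    using c d by (intro low_add low_scale) (auto simp: unit_in)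
  then have "word x u - (c * d) * word x w \<in> low (length u)"
    by (simp add: algebra_simps)
  then show ?thesis using assms unit_mult[OF c(1) d(1)] by (auto simp: similar_def)
qed

lemma sigma_unit:
  assumes "i < n" "unit c"
  shows "unit (\<sigma> i c)"
proof -
  obtain d where "d \<in> R" "c * d = 1" "d * c = 1" using assms(2) by (metis unit_inverse unit_in)
  then have "\<sigma> i c * \<sigma> i d = 1" "\<sigma> i d * \<sigma> i c = 1"
    using assms by (simp_all add: sigma_one unit_in flip: sigma_mult)
  then show ?thesis
    using assms \<open>d \<in> R\<close> sigma_in unit_in unfolding unit_def invertible_in_def by blast
qed

lemma similar_Cons:
  assumes "similar u v" "i < n"
  shows "similar (i # u) (i # v)"
proof -
  obtain c where c: "unit c" "word x u - c * word x v \<in> low (length u)"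
    and len: "length u = length v" "set v \<subseteq> {..<n}"
    using assms by (auto simp: similar_def)
  have "x i * (word x u - c * word x v) + (x i * c - \<sigma> i c * x i) * word x v \<in> low (Suc (length u))"
    using c len assms by (intro low_add low_lmult_var low_scale low_word sigma_rem)
      (auto simp: unit_in)
  then have "word x (i # u) - \<sigma> i c * word x (i # v) \<in> low (length (i # u))"
    by (simp add: algebra_simps)
  then show ?thesis
    using len assms(2) sigma_unit[OF assms(2) c(1)] by (auto simp: similar_def)
qed

lemma lin_part_rmult_word:
  assumes "f \<in> lin_part R n x" "set w \<subseteq> {..<n}"
  shows "f * word x w \<in> low (Suc (Suc (length w)))"
proof -
  obtain s r where f: "s \<in> R" "r \<in> {..<n} \<rightarrow> R" "f = s + (\<Sum>k<n. r k * x k)"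
    using assms(1) by (auto simp: lin_part_def)
  have "f * word x w = s * word x w + (\<Sum>k<n. r k * word x (k # w))"
    by (simp add: f distrib_right sum_distrib_right mult.assoc)
  also have "\<dots> \<in> low (Suc (Suc (length w)))"
  proof (rule low_add)
    show "s * word x w \<in> low (Suc (Suc (length w)))"
      using f assms by (intro low_scale low_word) auto
    show "(\<Sum>k<n. r k * word x (k # w)) \<in> low (Suc (Suc (length w)))"
      unfolding low_def
    proof (rule lspan_sum, fold low_def)
      show "r k * word x (k # w) \<in> low (Suc (Suc (length w)))" if "k \<in> {..<n}" for k
        using f that assms by (intro low_scale low_word) auto
    qed
  qed
  finally show ?thesis .
qed

text \<open>
  The axioms provide an invertible commutation coefficient when the smaller index is moved to the
  front; the opposite exchange is its inverse.
\<close>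

lemma similar_swap:
  assumes "i < n" "j < n" "set w \<subseteq> {..<n}"
  shows "similar (j # i # w) (i # j # w)"
proof -
  have *: "similar (j # i # w) (i # j # w)" if ij: "i < j" "j < n" for i j
  proof -
    obtain c where c: "unit c" "x j * x i - c * x i * x j \<in> lin_part R n x"
      using swap_vars[OF ij] by auto
    then have "(x j * x i - c * x i * x j) * word x w \<in> low (length (j # i # w))"
      using lin_part_rmult_word assms(3) by auto
    then have "word x (j # i # w) - c * word x (i # j # w) \<in> low (length (j # i # w))"
      by (simp add: algebra_simps)
    then show ?thesis using c assms(3) ij by (auto simp: similar_def)
  qed
  show ?thesis
    using *[of i j] similar_sym[OF *[of j i]] similar_refl[of "j # i # w"] assms
    by (cases i j rule: linorder_cases) auto
qed

lemma similar_move_front: "set (p @ a # q) \<subseteq> {..<n} \<Longrightarrow> similar (p @ a # q) (a # p @ q)"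
proof (induction p)
  case (Cons b p)
  then have "similar (b # p @ a # q) (b # a # p @ q)" by (auto intro: similar_Cons)
  then show ?case using similar_trans similar_swap[of a b "p @ q"] Cons.prems by auto
qed (simp add: similar_refl)

text \<open>
  Sorting by selection: the first letter of \<open>u\<close> is moved to the front of \<open>v\<close>, then the tails are
  compared.
\<close>

lemma similar_mset:
  "mset u = mset v \<Longrightarrow> set u \<subseteq> {..<n} \<Longrightarrow> similar u v"
proof (induction u arbitrary: v)
  case Nil
  then show ?case by (simp add: similar_refl)
next
  case (Cons a u)
  then have "a \<in> set v" by (metis list.set_intros(1) mset_eq_setD)
  then obtain p q where v: "v = p @ a # q" by (meson split_list)
  have "set v \<subseteq> {..<n}" using Cons.prems mset_eq_setD by metis
  moreover have "similar (a # u) (a # p @ q)"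
    using Cons v by (intro similar_Cons) auto
  ultimately show ?case
    using similar_trans similar_sym[OF similar_move_front] unfolding v by auto
qed

text \<open>
  A word of length \<open>d\<close> is similar to the standard monomial with the same letters, and the error term
  consists of shorter words, to which the induction hypothesis applies.
\<close>

lemma low_lspan_mon: "low d = lspan R (m ` {\<alpha> \<in> expo n. td \<alpha> < d})"
proof (induction d)
  case 0
  show ?case by (simp add: low_def)
next
  case (Suc d)
  let ?M = "\<lambda>d. m ` {\<alpha> \<in> expo n. td \<alpha> < d}"
  have mono: "f \<in> lspan R (?M (Suc d))" if "f \<in> low d" for f
    using that unfolding Suc by (rule lspan_mono) auto
  show ?case
  proof (intro equalityI subsetI)
    fix f assume "f \<in> low (Suc d)"
    then show "f \<in> lspan R (?M (Suc d))"
      unfolding low_def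
    proof (rule lspan_subset)
      fix s assume "s \<in> {word x w |w. set w \<subseteq> {..<n} \<and> length w < Suc d}"
      then obtain w where w: "s = word x w" "set w \<subseteq> {..<n}" "length w < Suc d" by auto
      define \<alpha> where "\<alpha> = count (mset w)"
      have \<alpha>: "\<alpha> \<in> expo n" "mset (sorted_word n \<alpha>) = mset w"
        using w by (simp_all add: \<alpha>_def expo_count mset_sorted_word_count)
      then have td: "td \<alpha> = length w" by (metis length_sorted_word size_mset)
      obtain c where c: "unit c" "word x w - c * m \<alpha> \<in> low (length w)"
        using similar_mset[OF \<alpha>(2)[symmetric] w(2)] by (auto simp: similar_def word_sorted_word)
      have "word x w - c * m \<alpha> \<in> lspan R (?M (Suc d))"
        using w by (intro mono low_mono[OF c(2)]) auto
      moreover have "c * m \<alpha> \<in> lspan R (?M (Suc d))"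
        using c w \<alpha> td by (intro lspan_scale lspan_base) (auto simp: unit_in)
      ultimately have "(word x w - c * m \<alpha>) + c * m \<alpha> \<in> lspan R (?M (Suc d))" by (rule lspan_add)
      then show "s \<in> lspan R (?M (Suc d))" by (simp add: w)
    qed
  next
    fix f assume "f \<in> lspan R (?M (Suc d))"
    then show "f \<in> low (Suc d)"
      unfolding low_def
    proof (rule lspan_subset, fold low_def)
      fix s assume "s \<in> ?M (Suc d)"
      then show "s \<in> low (Suc d)"
        by (auto simp: set_sorted_word length_sorted_word simp flip: word_sorted_word
            intro!: low_word dest!: subsetD[OF set_sorted_word])
    qed
  qed
qed

lemma low_iff: "f \<in> low d \<longleftrightarrow> (\<forall>\<alpha>. cf f \<alpha> \<noteq> 0 \<longrightarrow> td \<alpha> < d)"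
  using supp_expo by (auto simp: low_lspan_mon lspan_mon_iff)

lemma low_iff_deg: "f \<in> low d \<longleftrightarrow> f = 0 \<or> deg R n x f < d"
proof (cases "f = 0")
  case False
  then have "{\<alpha>. cf f \<alpha> \<noteq> 0} \<noteq> {}" using coef_eq_0_imp by blast
  then show ?thesis
    using False finite_supp[of f] by (auto simp: low_iff deg_def)
qed (simp add: low_zero)

section \<open>Products of monomials\<close>

lemma low_lmult_mon: "f \<in> low d \<Longrightarrow> m \<alpha> * f \<in> low (td \<alpha> + d)"
  using low_lmult_word[OF _ set_sorted_word] by (simp add: word_sorted_word length_sorted_word)

lemma low_rmult_mon: "f \<in> low d \<Longrightarrow> f * m \<alpha> \<in> low (d + td \<alpha>)"
  using low_rmult_word[OF _ set_sorted_word] by (simp add: word_sorted_word length_sorted_word)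

lemma term_low_iff:
  assumes "r \<in> R" "\<alpha> \<in> expo n"
  shows "r * m \<alpha> \<in> low (td \<alpha>) \<longleftrightarrow> r = 0"
  using assms by (auto simp: low_iff coef_term)

text \<open>
  The word of \<open>x\<^sup>\<alpha> x\<^sup>\<beta>\<close> is a rearrangement of the word of \<open>x\<^bsup>\<alpha>+\<beta>\<^esup>\<close>, so the two are similar; the unit
  obtained from sorting meets the description that defines \<open>mult_coeff\<close>.
\<close>

lemma mult_coeff:
  assumes "\<alpha> \<in> expo n" "\<beta> \<in> expo n"
  shows unit_mult_coeff: "unit (mc \<alpha> \<beta>)"
    and mult_coeff_rem: "m \<alpha> * m \<beta> - mc \<alpha> \<beta> * m (\<alpha> + \<beta>) \<in> low (td (\<alpha> + \<beta>))"
proof -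
  let ?P = "\<lambda>c. m \<alpha> * m \<beta> - c * m (\<alpha> + \<beta>) \<in> low (td (\<alpha> + \<beta>))"
  have "similar (sorted_word n \<alpha> @ sorted_word n \<beta>) (sorted_word n (\<alpha> + \<beta>))"
    by (rule similar_mset) (simp_all add: mset_sorted_word_add set_sorted_word)
  then obtain c where c: "unit c" "?P c"
    by (auto simp: similar_def word_sorted_word length_sorted_word total_deg_add)
  have iff: "(\<exists>p. m \<alpha> * m \<beta> = d * m (\<alpha> + \<beta>) + p \<and> (p = 0 \<or> deg R n x p < td (\<alpha> + \<beta>))) \<longleftrightarrow> ?P d" for d
    unfolding low_iff_deg[symmetric] by (auto simp: algebra_simps intro!: exI[of _ "m \<alpha> * m \<beta> - d * m (\<alpha> + \<beta>)"])
  have "mc \<alpha> \<beta> = c"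
    unfolding mult_coeff_def iff
  proof (rule the_equality)
    fix d assume d: "d \<in> R \<and> ?P d"
    then have "(m \<alpha> * m \<beta> - c * m (\<alpha> + \<beta>)) - (m \<alpha> * m \<beta> - d * m (\<alpha> + \<beta>)) \<in> low (td (\<alpha> + \<beta>))"
      using c by (blast intro: low_diff)
    then have "(d - c) * m (\<alpha> + \<beta>) \<in> low (td (\<alpha> + \<beta>))"
      by (simp add: algebra_simps)
    then show "d = c" using term_low_iff[of "d - c" "\<alpha> + \<beta>"] c d assms by (simp add: R_diff unit_in)
  qed (use c in \<open>auto simp: unit_in\<close>)
  then show "unit (mc \<alpha> \<beta>)" "?P (mc \<alpha> \<beta>)" using c by auto
qed

lemma mult_coeff_in [simp]: "\<alpha> \<in> expo n \<Longrightarrow> \<beta> \<in> expo n \<Longrightarrow> mc \<alpha> \<beta> \<in> R"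
  by (simp add: unit_mult_coeff unit_in)

lemma sigma_pow_in [simp]: "r \<in> R \<Longrightarrow> sp \<alpha> r \<in> R"
  by (simp add: sigma_pow_word sigma_word_in set_sorted_word)

lemma sigma_word_ring_hom:
  assumes "set w \<subseteq> {..<n}" "r \<in> R" "s \<in> R"
  shows "sigma_word w (r + s) = sigma_word w r + sigma_word w s"
    and "sigma_word w (r * s) = sigma_word w r * sigma_word w s"
  using assms by (induction w) (auto simp: sigma_add sigma_mult sigma_word_in)

lemma sigma_pow_add: "r \<in> R \<Longrightarrow> s \<in> R \<Longrightarrow> sp \<alpha> (r + s) = sp \<alpha> r + sp \<alpha> s"
  and sigma_pow_mult: "r \<in> R \<Longrightarrow> s \<in> R \<Longrightarrow> sp \<alpha> (r * s) = sp \<alpha> r * sp \<alpha> s"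
  by (simp_all add: sigma_pow_word sigma_word_ring_hom set_sorted_word)

lemma sigma_pow_zero [simp]: "sp \<alpha> 0 = 0"
  using sigma_pow_add[of 0 0 \<alpha>] by simp

lemma sigma_pow_sum:
  "(\<And>i. i \<in> A \<Longrightarrow> f i \<in> R) \<Longrightarrow> sp \<alpha> (sum f A) = (\<Sum>i\<in>A. sp \<alpha> (f i))"
  by (induction A rule: infinite_finite_induct) (auto simp: sigma_pow_add R_sum)

lemma sigma_pow_bij: "bij_betw (sp \<alpha>) R R"
proof -
  have "bij_betw (sigma_word w) R R" if "set w \<subseteq> {..<n}" for w
    using that by (induction w) (auto intro: bij_betw_trans sigma_bij)
  then show ?thesis by (simp add: sigma_pow_word set_sorted_word)
qed

lemma mon_mult_term:
  assumes "\<alpha> \<in> expo n" "\<beta> \<in> expo n" "r \<in> R"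
  shows "m \<alpha> * (r * m \<beta>) - sp \<alpha> r * mc \<alpha> \<beta> * m (\<alpha> + \<beta>) \<in> low (td (\<alpha> + \<beta>))"
proof -
  have "m \<alpha> * r - sp \<alpha> r * m \<alpha> \<in> low (td \<alpha>)"
    using sigma_word_rem[OF set_sorted_word assms(3), of \<alpha>]
    by (simp add: word_sorted_word length_sorted_word sigma_pow_word)
  then have "(m \<alpha> * r - sp \<alpha> r * m \<alpha>) * m \<beta> \<in> low (td (\<alpha> + \<beta>))"
    unfolding total_deg_add by (rule low_rmult_mon)
  moreover have "sp \<alpha> r * (m \<alpha> * m \<beta> - mc \<alpha> \<beta> * m (\<alpha> + \<beta>)) \<in> low (td (\<alpha> + \<beta>))"
    using assms by (intro low_scale mult_coeff_rem) auto
  ultimately have "(m \<alpha> * r - sp \<alpha> r * m \<alpha>) * m \<beta> + sp \<alpha> r * (m \<alpha> * m \<beta> - mc \<alpha> \<beta> * m (\<alpha> + \<beta>))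
    \<in> low (td (\<alpha> + \<beta>))"
    by (rule low_add)
  then show ?thesis by (simp add: algebra_simps)
qed

text \<open>
  Both sides are the coefficient of \<open>x\<^bsup>\<theta>+\<gamma>+\<beta>\<^esup>\<close> in \<open>x\<^sup>\<theta> x\<^sup>\<gamma> (r x\<^sup>\<beta>)\<close>: on the left the two monomials are
  multiplied first, on the right \<open>x\<^sup>\<gamma>\<close> acts on \<open>r x\<^sup>\<beta>\<close> first.
\<close>

lemma mult_coeff_assoc:
  assumes \<theta>: "\<theta> \<in> expo n" and \<gamma>: "\<gamma> \<in> expo n" and \<beta>: "\<beta> \<in> expo n" and r: "r \<in> R"
  shows "mc \<theta> \<gamma> * (sp (\<theta> + \<gamma>) r * mc (\<theta> + \<gamma>) \<beta>) = sp \<theta> (sp \<gamma> r * mc \<gamma> \<beta>) * mc \<theta> (\<gamma> + \<beta>)"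
proof -
  define s where "s = sp \<gamma> r * mc \<gamma> \<beta>"
  have s: "s \<in> R" by (simp add: s_def assms)
  let ?L = "low (td (\<theta> + \<gamma> + \<beta>))"
  let ?X = "m \<theta> * m \<gamma> * (r * m \<beta>)"
  have l1: "(m \<theta> * m \<gamma> - mc \<theta> \<gamma> * m (\<theta> + \<gamma>)) * r * m \<beta> \<in> ?L"
    using low_rmult_mon[OF low_rmult_R[OF mult_coeff_rem[OF \<theta> \<gamma>] r]] by (simp add: total_deg_add)
  have l2: "mc \<theta> \<gamma> * (m (\<theta> + \<gamma>) * (r * m \<beta>) -
      sp (\<theta> + \<gamma>) r * mc (\<theta> + \<gamma>) \<beta> * m (\<theta> + \<gamma> + \<beta>)) \<in> ?L"
    by (intro low_scale mon_mult_term) (simp_all add: assms)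
  have left:
    "?X - mc \<theta> \<gamma> * (sp (\<theta> + \<gamma>) r * mc (\<theta> + \<gamma>) \<beta>) * m (\<theta> + \<gamma> + \<beta>) \<in> ?L"
    using low_add[OF l1 l2] by (simp add: algebra_simps)
  have r1: "m \<theta> * (m \<gamma> * (r * m \<beta>) - s * m (\<gamma> + \<beta>)) \<in> ?L"
    using low_lmult_mon[OF mon_mult_term[OF \<gamma> \<beta> r]] by (simp add: s_def total_deg_add add.assoc)
  have r2: "m \<theta> * (s * m (\<gamma> + \<beta>)) - sp \<theta> s * mc \<theta> (\<gamma> + \<beta>) * m (\<theta> + \<gamma> + \<beta>) \<in> ?L"
    using mon_mult_term[of \<theta> "\<gamma> + \<beta>" s] assms s by (simp add: add.assoc)
  have right: "?X - sp \<theta> s * mc \<theta> (\<gamma> + \<beta>) * m (\<theta> + \<gamma> + \<beta>) \<in> ?L"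
    using low_add[OF r1 r2] by (simp add: algebra_simps)
  have "(sp \<theta> s * mc \<theta> (\<gamma> + \<beta>) - mc \<theta> \<gamma> * (sp (\<theta> + \<gamma>) r * mc (\<theta> + \<gamma>) \<beta>)) * m (\<theta> + \<gamma> + \<beta>) \<in> ?L"
    using low_diff[OF left right] by (simp add: left_diff_distrib)
  then show ?thesis
    using term_low_iff[of _ "\<theta> + \<gamma> + \<beta>"] s assms by (simp add: R_diff s_def)
qed

end

section \<open>Leading terms\<close>

locale ordered_skew_PBW = skew_PBW_extension +
  fixes ord :: "'a rel"
  assumes monomial_order: "monomial_order R n x ord"
begin

abbreviation "led \<equiv> lexp R n x ord"
abbreviation "lcf \<equiv> lc R n x ord"

lemma ord_refl: "\<alpha> \<in> expo n \<Longrightarrow> (m \<alpha>, m \<alpha>) \<in> ord"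
  and ord_trans: "(X, Y) \<in> ord \<Longrightarrow> (Y, Z) \<in> ord \<Longrightarrow> (X, Z) \<in> ord"
  and ord_antisym: "\<alpha> \<in> expo n \<Longrightarrow> \<beta> \<in> expo n \<Longrightarrow> (m \<alpha>, m \<beta>) \<in> ord \<Longrightarrow> (m \<beta>, m \<alpha>) \<in> ord \<Longrightarrow> \<alpha> = \<beta>"
  and ord_total: "\<alpha> \<in> expo n \<Longrightarrow> \<beta> \<in> expo n \<Longrightarrow> (m \<alpha>, m \<beta>) \<in> ord \<or> (m \<beta>, m \<alpha>) \<in> ord"
proof -
  have lin: "refl_on (Mon n x) ord" "trans ord" "antisym ord" "total_on (Mon n x) ord"
    using monomial_order
    by (simp_all add: monomial_order_def linear_order_on_def partial_order_on_def preorder_on_def)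
  have in_Mon: "m \<alpha> \<in> Mon n x" if "\<alpha> \<in> expo n" for \<alpha> using that by (simp add: Mon_def)
  show "\<alpha> \<in> expo n \<Longrightarrow> (m \<alpha>, m \<alpha>) \<in> ord"
    using lin(1) in_Mon by (auto dest: refl_onD)
  show "(X, Y) \<in> ord \<Longrightarrow> (Y, Z) \<in> ord \<Longrightarrow> (X, Z) \<in> ord"
    using lin(2) by (auto dest: transD)
  show "\<alpha> \<in> expo n \<Longrightarrow> \<beta> \<in> expo n \<Longrightarrow> (m \<alpha>, m \<beta>) \<in> ord \<Longrightarrow> (m \<beta>, m \<alpha>) \<in> ord \<Longrightarrow> \<alpha> = \<beta>"
    using lin(3) by (metis antisymD mon_inj)
  show "\<alpha> \<in> expo n \<Longrightarrow> \<beta> \<in> expo n \<Longrightarrow> (m \<alpha>, m \<beta>) \<in> ord \<or> (m \<beta>, m \<alpha>) \<in> ord"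
    using lin(1,4) in_Mon by (metis total_on_def refl_onD)
qed

lemma ord_total_deg: "\<alpha> \<in> expo n \<Longrightarrow> \<beta> \<in> expo n \<Longrightarrow> td \<alpha> < td \<beta> \<Longrightarrow> (m \<alpha>, m \<beta>) \<in> ord"
  using monomial_order mon_nonzero by (auto simp: monomial_order_def mon_ge_def)

text \<open>
  The position of \<open>x\<^sup>\<alpha>\<close> in the monomial order.  Only finitely many monomials lie below \<open>x\<^sup>\<alpha>\<close>, because
  they have no larger total degree, so the position is a natural number.
\<close>

definition rk :: "(nat \<Rightarrow> nat) \<Rightarrow> nat" where
  "rk \<alpha> = card {\<beta> \<in> expo n. (m \<beta>, m \<alpha>) \<in> ord \<and> \<beta> \<noteq> \<alpha>}"

lemma rk_mono:
  assumes "\<alpha> \<in> expo n" "\<beta> \<in> expo n" "(m \<alpha>, m \<beta>) \<in> ord" "\<alpha> \<noteq> \<beta>"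
  shows "rk \<alpha> < rk \<beta>"
  unfolding rk_def
proof (rule psubset_card_mono)
  have "td \<gamma> \<le> td \<beta>" if "\<gamma> \<in> expo n" "(m \<gamma>, m \<beta>) \<in> ord" for \<gamma>
    using that assms(2) ord_total_deg ord_antisym by (metis linorder_not_le order_refl)
  then show "finite {\<gamma> \<in> expo n. (m \<gamma>, m \<beta>) \<in> ord \<and> \<gamma> \<noteq> \<beta>}"
    by (intro rev_finite_subset[OF finite_expo_bounded[of n "td \<beta>"]]) auto
  show "{\<gamma> \<in> expo n. (m \<gamma>, m \<alpha>) \<in> ord \<and> \<gamma> \<noteq> \<alpha>} \<subset> {\<gamma> \<in> expo n. (m \<gamma>, m \<beta>) \<in> ord \<and> \<gamma> \<noteq> \<beta>}"
    using assms ord_trans ord_antisym by blast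
qed

lemma rk_less_iff:
  assumes "\<alpha> \<in> expo n" "\<beta> \<in> expo n"
  shows "rk \<alpha> < rk \<beta> \<longleftrightarrow> (m \<alpha>, m \<beta>) \<in> ord \<and> \<alpha> \<noteq> \<beta>"
  using assms rk_mono ord_total by (metis less_asym less_irrefl)

lemma rk_inj: "\<alpha> \<in> expo n \<Longrightarrow> \<beta> \<in> expo n \<Longrightarrow> rk \<alpha> = rk \<beta> \<Longrightarrow> \<alpha> = \<beta>"
  using rk_less_iff ord_total by (metis less_irrefl)

lemma rk_le_iff:
  "\<alpha> \<in> expo n \<Longrightarrow> \<beta> \<in> expo n \<Longrightarrow> rk \<alpha> \<le> rk \<beta> \<longleftrightarrow> (m \<alpha>, m \<beta>) \<in> ord"
  using rk_less_iff[of \<alpha> \<beta>] rk_inj[of \<alpha> \<beta>] ord_refl by (metis le_less)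

lemma rk_total_deg: "\<alpha> \<in> expo n \<Longrightarrow> \<beta> \<in> expo n \<Longrightarrow> td \<alpha> < td \<beta> \<Longrightarrow> rk \<alpha> < rk \<beta>"
  using rk_less_iff ord_total_deg by auto

lemma lm_eqI:
  assumes "cf f \<alpha> \<noteq> 0" "\<And>\<beta>. cf f \<beta> \<noteq> 0 \<Longrightarrow> rk \<beta> \<le> rk \<alpha>"
  shows "lm R n x ord f = m \<alpha>"
proof -
  have "(THE X. X \<in> m ` {\<alpha>. cf f \<alpha> \<noteq> 0} \<and> (\<forall>Y\<in>m ` {\<alpha>. cf f \<alpha> \<noteq> 0}. (Y, X) \<in> ord)) = m \<alpha>"
  proof (rule the_equality)
    show "m \<alpha> \<in> m ` {\<alpha>. cf f \<alpha> \<noteq> 0} \<and> (\<forall>Y\<in>m ` {\<alpha>. cf f \<alpha> \<noteq> 0}. (Y, m \<alpha>) \<in> ord)"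
      using assms rk_le_iff supp_expo by auto
  next
    fix X assume "X \<in> m ` {\<alpha>. cf f \<alpha> \<noteq> 0} \<and> (\<forall>Y\<in>m ` {\<alpha>. cf f \<alpha> \<noteq> 0}. (Y, X) \<in> ord)"
    then obtain \<beta> where "X = m \<beta>" "cf f \<beta> \<noteq> 0" "(m \<alpha>, m \<beta>) \<in> ord" using assms(1) by auto
    then show "X = m \<alpha>" using assms rk_le_iff supp_expo ord_antisym by metis
  qed
  then show ?thesis using assms(1) by (auto simp: lm_def)
qed

lemma lexp_eqI:
  assumes "cf f \<alpha> \<noteq> 0" "\<And>\<beta>. cf f \<beta> \<noteq> 0 \<Longrightarrow> rk \<beta> \<le> rk \<alpha>"
  shows "led f = \<alpha>"
  using lm_eqI[OF assms] supp_expo[OF assms(1)] by (simp add: exp_of_mon)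

lemma
  assumes "f \<noteq> 0"
  shows coef_lexp: "cf f (led f) \<noteq> 0" and rk_lexp: "cf f \<beta> \<noteq> 0 \<Longrightarrow> rk \<beta> \<le> rk (led f)"
proof -
  let ?S = "{\<alpha>. cf f \<alpha> \<noteq> 0}"
  have S: "finite ?S" "?S \<noteq> {}" using finite_supp coef_eq_0_imp assms by auto
  then have "Max (rk ` ?S) \<in> rk ` ?S" by (intro Max_in) auto
  then obtain \<alpha> where \<alpha>: "cf f \<alpha> \<noteq> 0" "rk \<alpha> = Max (rk ` ?S)" by auto
  have max: "rk \<beta> \<le> rk \<alpha>" if "cf f \<beta> \<noteq> 0" for \<beta>
    unfolding \<alpha> using S that by (intro Max_ge) auto
  have "led f = \<alpha>" using \<alpha>(1) max by (rule lexp_eqI)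
  then show "cf f (led f) \<noteq> 0" "cf f \<beta> \<noteq> 0 \<Longrightarrow> rk \<beta> \<le> rk (led f)" using \<alpha> max by auto
qed

lemma lc_eq: "f \<noteq> 0 \<Longrightarrow> lcf f = cf f (led f)"
  by (simp add: lc_def)

lemma lexp_expo: "f \<noteq> 0 \<Longrightarrow> led f \<in> expo n"
  using coef_lexp supp_expo by blast

lemma lc_in: "f \<noteq> 0 \<Longrightarrow> lcf f \<in> R"
  by (simp add: lc_eq)

lemma lm_mon_mult:
  assumes "\<gamma> \<in> expo n" "\<alpha> \<in> expo n"
  shows "lm R n x ord (m \<gamma> * m \<alpha>) = m (\<gamma> + \<alpha>)"
proof (rule lm_eqI)
  have rem: "m \<gamma> * m \<alpha> - mc \<gamma> \<alpha> * m (\<gamma> + \<alpha>) \<in> low (td (\<gamma> + \<alpha>))"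
    using assms by (rule mult_coeff_rem)
  have cf: "cf (m \<gamma> * m \<alpha>) \<beta> = (if \<beta> = \<gamma> + \<alpha> then mc \<gamma> \<alpha> else 0)" if "\<not> td \<beta> < td (\<gamma> + \<alpha>)" for \<beta>
  proof -
    have "cf (m \<gamma> * m \<alpha> - mc \<gamma> \<alpha> * m (\<gamma> + \<alpha>)) \<beta> = 0"
      using rem that unfolding low_iff by blast
    then show ?thesis using assms by (simp add: coef_diff coef_term)
  qed
  show "cf (m \<gamma> * m \<alpha>) (\<gamma> + \<alpha>) \<noteq> 0"
    using cf[of "\<gamma> + \<alpha>"] unit_mult_coeff[OF assms] unit_nonzero by auto
  show "rk \<beta> \<le> rk (\<gamma> + \<alpha>)" if "cf (m \<gamma> * m \<alpha>) \<beta> \<noteq> 0" for \<beta>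
    using that cf[of \<beta>] rk_total_deg[of \<beta> "\<gamma> + \<alpha>"] supp_expo[OF that] assms
    by (cases "\<beta> = \<gamma> + \<alpha>") (auto intro: less_imp_le)
qed

lemma mon_0: "m 0 = 1"
proof -
  have "length (sorted_word n 0) = 0"
    unfolding length_sorted_word by (simp add: total_deg_def)
  then show ?thesis using word_sorted_word[of x n 0] by simp
qed

text \<open>
  Compatibility of the order with products speaks about \<open>lm (x\<^sup>\<gamma> x\<^sup>\<beta> x\<^sup>\<mu>)\<close>.  With \<open>\<mu> = 0\<close> this is
  \<open>x\<^bsup>\<gamma>+\<beta>\<^esup>\<close> because multiplication coefficients are units, and strictness comes from cancellation of
  exponents.
\<close>

lemma rk_add:
  assumes "\<alpha> \<in> expo n" "\<beta> \<in> expo n" "\<gamma> \<in> expo n" "rk \<alpha> < rk \<beta>"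
  shows "rk (\<gamma> + \<alpha>) < rk (\<gamma> + \<beta>)"
proof -
  have zero: "0 \<in> expo n" by (simp add: expo_def)
  have "mon_ge ord (m \<beta>) (m \<alpha>)" using assms rk_less_iff by (auto simp: mon_ge_def)
  then have "mon_ge ord (lm R n x ord (m \<gamma> * m \<beta> * m 0)) (lm R n x ord (m \<gamma> * m \<alpha> * m 0))"
    using monomial_order assms zero unfolding monomial_order_def by blast
  then have "(m (\<gamma> + \<alpha>), m (\<gamma> + \<beta>)) \<in> ord"
    using assms by (simp add: mon_0 lm_mon_mult mon_ge_def mon_nonzero)
  moreover have "\<gamma> + \<alpha> \<noteq> \<gamma> + \<beta>"
    using assms(4) by auto
  ultimately show ?thesis using assms rk_less_iff by simp
qed

definition below :: "nat \<Rightarrow> 'a set" where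
  "below k = {f. \<forall>\<alpha>. cf f \<alpha> \<noteq> 0 \<longrightarrow> rk \<alpha> < k}"

lemma below_zero: "0 \<in> below k"
  by (simp add: below_def)

lemma below_add: "f \<in> below k \<Longrightarrow> g \<in> below k \<Longrightarrow> f + g \<in> below k"
  by (force simp: below_def coef_add)

lemma below_diff: "f \<in> below k \<Longrightarrow> g \<in> below k \<Longrightarrow> f - g \<in> below k"
  by (force simp: below_def coef_diff)

lemma below_scale: "f \<in> below k \<Longrightarrow> r \<in> R \<Longrightarrow> r * f \<in> below k"
  by (force simp: below_def coef_scale)

lemma below_mono: "f \<in> below k \<Longrightarrow> k \<le> l \<Longrightarrow> f \<in> below l"
  by (force simp: below_def)

lemma below_term: "r \<in> R \<Longrightarrow> \<alpha> \<in> expo n \<Longrightarrow> rk \<alpha> < k \<Longrightarrow> r * m \<alpha> \<in> below k"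
  by (simp add: below_def coef_term)

lemma low_below: "f \<in> low (td \<alpha>) \<Longrightarrow> \<alpha> \<in> expo n \<Longrightarrow> f \<in> below (rk \<alpha>)"
  using supp_expo by (auto simp: below_def low_iff intro: rk_total_deg)

lemma below_lexp: "f \<noteq> 0 \<Longrightarrow> f \<in> below k \<longleftrightarrow> rk (led f) < k"
  using coef_lexp rk_lexp by (force simp: below_def)

text \<open>
  Only one exponent has rank \<open>rk \<alpha>\<close>, so cancelling its coefficient lowers the bound by one.
\<close>

lemma below_cancel:
  assumes "f \<in> below (Suc (rk \<alpha>))" "\<alpha> \<in> expo n" "cf f \<alpha> = 0"
  shows "f \<in> below (rk \<alpha>)"
  unfolding below_def
proof (intro CollectI allI impI)
  fix \<beta> assume \<beta>: "cf f \<beta> \<noteq> 0"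
  then have "rk \<beta> \<le> rk \<alpha>" "\<beta> \<noteq> \<alpha>" using assms by (auto simp: below_def less_Suc_eq_le)
  then show "rk \<beta> < rk \<alpha>" using rk_inj[OF supp_expo[OF \<beta>] assms(2)] by linarith
qed

text \<open>
  The error terms of \<open>x\<^sup>\<alpha> (r x\<^sup>\<kappa>)\<close> have degree less than \<open>\<alpha> + \<kappa>\<close>, hence smaller rank, and for
  \<open>\<kappa> \<noteq> \<beta>\<close> the main term is below \<open>x\<^bsup>\<alpha>+\<beta>\<^esup>\<close> by monotonicity.  The coefficient of \<open>f\<close> at \<open>\<beta>\<close> may
  vanish, which lets the induction proceed term by term.
\<close>

lemma leading_term_mult:
  assumes "f \<in> below (Suc (rk \<beta>))" "\<alpha> \<in> expo n" "\<beta> \<in> expo n"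
  shows "m \<alpha> * f - sp \<alpha> (cf f \<beta>) * mc \<alpha> \<beta> * m (\<alpha> + \<beta>) \<in> below (rk (\<alpha> + \<beta>))"
proof -
  have "f \<in> lspan R (m ` {\<kappa> \<in> expo n. rk \<kappa> < Suc (rk \<beta>)})"
    using assms(1) supp_expo by (subst lspan_mon_iff) (auto simp: below_def)
  then show ?thesis
  proof induction
    case zero
    then show ?case by (simp add: below_zero)
  next
    case (step r s f)
    then obtain \<kappa> where \<kappa>: "\<kappa> \<in> expo n" "rk \<kappa> \<le> rk \<beta>" "s = m \<kappa>" by (auto simp: less_Suc_eq_le)
    define t where "t = (if \<beta> = \<kappa> then r else 0)"
    have "m \<alpha> * (r * m \<kappa>) - sp \<alpha> t * mc \<alpha> \<beta> * m (\<alpha> + \<beta>) \<in> below (rk (\<alpha> + \<beta>))"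
    proof (cases "\<kappa> = \<beta>")
      case True
      then show ?thesis using low_below[OF mon_mult_term] assms step by (simp add: t_def)
    next
      case False
      then have less: "rk (\<alpha> + \<kappa>) < rk (\<alpha> + \<beta>)"
        using \<kappa> assms rk_inj[of \<kappa> \<beta>] by (intro rk_add) auto
      have "m \<alpha> * (r * m \<kappa>) - sp \<alpha> r * mc \<alpha> \<kappa> * m (\<alpha> + \<kappa>) \<in> below (rk (\<alpha> + \<beta>))"
        using less assms step \<kappa> by (intro below_mono[OF low_below[OF mon_mult_term]]) auto
      moreover have "sp \<alpha> r * mc \<alpha> \<kappa> * m (\<alpha> + \<kappa>) \<in> below (rk (\<alpha> + \<beta>))"
        using less assms step \<kappa> by (intro below_term) auto
      ultimately show ?thesis using False below_add by (fastforce simp: t_def)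
    qed
    from below_add[OF this step.IH] show ?case
    proof (rule back_subst[of "\<lambda>h. h \<in> below (rk (\<alpha> + \<beta>))"])
      have "cf (r * s + f) \<beta> = t + cf f \<beta>"
        using step \<kappa> by (simp add: coef_add coef_term t_def)
      moreover have "sp \<alpha> (t + cf f \<beta>) = sp \<alpha> t + sp \<alpha> (cf f \<beta>)"
        using step by (intro sigma_pow_add) (auto simp: t_def)
      ultimately show "m \<alpha> * (r * m \<kappa>) - sp \<alpha> t * mc \<alpha> \<beta> * m (\<alpha> + \<beta>) +
          (m \<alpha> * f - sp \<alpha> (cf f \<beta>) * mc \<alpha> \<beta> * m (\<alpha> + \<beta>)) =
        m \<alpha> * (r * s + f) - sp \<alpha> (cf (r * s + f) \<beta>) * mc \<alpha> \<beta> * m (\<alpha> + \<beta>)"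
        by (simp add: \<kappa> algebra_simps)
    qed
  qed
qed

lemma
  assumes "g \<noteq> 0" "\<alpha> \<in> expo n"
  shows mon_mult_below: "m \<alpha> * g \<in> below (Suc (rk (\<alpha> + led g)))"
    and coef_mon_mult: "cf (m \<alpha> * g) (\<alpha> + led g) = sp \<alpha> (lcf g) * mc \<alpha> (led g)"
proof -
  let ?t = "sp \<alpha> (lcf g) * mc \<alpha> (led g)"
  have g: "led g \<in> expo n" "lcf g \<in> R" using assms by (auto simp: lexp_expo lc_in)
  have rem: "m \<alpha> * g - ?t * m (\<alpha> + led g) \<in> below (rk (\<alpha> + led g))"
    using leading_term_mult[of g "led g" \<alpha>] assms g by (simp add: below_lexp lc_eq)
  have "?t * m (\<alpha> + led g) \<in> below (Suc (rk (\<alpha> + led g)))"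
    using g assms by (intro below_term) auto
  with rem have "(m \<alpha> * g - ?t * m (\<alpha> + led g)) + ?t * m (\<alpha> + led g) \<in> below (Suc (rk (\<alpha> + led g)))"
    by (intro below_add) (auto intro: below_mono)
  then show "m \<alpha> * g \<in> below (Suc (rk (\<alpha> + led g)))" by simp
  show "cf (m \<alpha> * g) (\<alpha> + led g) = ?t"
  proof -
    have "cf (m \<alpha> * g - ?t * m (\<alpha> + led g)) (\<alpha> + led g) = 0"
      using rem unfolding below_def by blast
    then show ?thesis using g assms by (simp add: coef_diff coef_term)
  qed
qed

section \<open>Combinations with bounded leading exponents\<close>

definition gens :: "'a set \<Rightarrow> nat \<Rightarrow> 'a set" where
  "gens G k = {m \<kappa> * g | \<kappa> g. \<kappa> \<in> expo n \<and> g \<in> G \<and> rk (\<kappa> + led g) < k}"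

text \<open>
  Elements with a representation by \<open>G\<close> in which every summand has leading exponent of rank below
  \<open>k\<close>.  This is in general smaller than the set of elements of the left ideal in \<open>below k\<close>: there,
  larger leading terms of the summands may cancel.
\<close>

definition filt :: "'a set \<Rightarrow> nat \<Rightarrow> 'a set" where
  "filt G k = lspan R (gens G k)"

lemma filt_add: "f \<in> filt G k \<Longrightarrow> g \<in> filt G k \<Longrightarrow> f + g \<in> filt G k"
  and filt_diff: "f \<in> filt G k \<Longrightarrow> g \<in> filt G k \<Longrightarrow> f - g \<in> filt G k"
  and filt_scale: "f \<in> filt G k \<Longrightarrow> r \<in> R \<Longrightarrow> r * f \<in> filt G k"
  and filt_zero: "0 \<in> filt G k"
  and filt_sum: "(\<And>i. i \<in> A \<Longrightarrow> h i \<in> filt G k) \<Longrightarrow> sum h A \<in> filt G k"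
  by (simp_all add: filt_def lspan_add lspan_diff lspan_scale lspan.zero lspan_sum)

lemma filt_mono: "f \<in> filt G k \<Longrightarrow> k \<le> l \<Longrightarrow> f \<in> filt G l"
  unfolding filt_def gens_def by (erule lspan_mono) (blast intro: order_less_le_trans)

lemma filt_gen: "\<kappa> \<in> expo n \<Longrightarrow> g \<in> G \<Longrightarrow> rk (\<kappa> + led g) < k \<Longrightarrow> m \<kappa> * g \<in> filt G k"
  unfolding filt_def by (rule lspan_base) (auto simp: gens_def)

lemma filt_below:
  assumes "0 \<notin> G" "f \<in> filt G k"
  shows "f \<in> below k"
  using assms(2) unfolding filt_def
proof induction
  case (step r s f)
  then obtain \<kappa> g where "\<kappa> \<in> expo n" "g \<in> G" "rk (\<kappa> + led g) < k" "s = m \<kappa> * g"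
    by (auto simp: gens_def)
  then have "s \<in> below k"
    using assms(1) by (auto intro: below_mono[OF mon_mult_below])
  then show ?case using step by (intro below_add below_scale)
qed (rule below_zero)

text \<open>
  This disposes of all error terms: whatever has lower degree than \<open>x\<^sup>\<alpha>\<close> contributes products whose
  leading exponents have rank less than that of \<open>x\<^sup>\<alpha> g\<close>.
\<close>

lemma low_mult_filt:
  assumes "p \<in> low (td \<alpha>)" "\<alpha> \<in> expo n" "g \<in> G" "g \<noteq> 0" "rk (\<alpha> + led g) \<le> k"
  shows "p * g \<in> filt G k"
  using assms(1) unfolding low_lspan_mon filt_def
proof (rule lspan_mult_right, fold filt_def)
  fix r s assume r: "r \<in> R" and "s \<in> m ` {\<kappa> \<in> expo n. td \<kappa> < td \<alpha>}"
  then obtain \<kappa> where \<kappa>: "s = m \<kappa>" "\<kappa> \<in> expo n" "td \<kappa> < td \<alpha>" by auto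
  then have "rk (\<kappa> + led g) < rk (\<alpha> + led g)"
    using assms by (intro rk_total_deg) (auto simp: total_deg_add lexp_expo)
  then have "s * g \<in> filt G k"
    unfolding \<kappa>(1) using \<kappa> assms by (intro filt_gen) auto
  then show "r * (s * g) \<in> filt G k" using r by (rule filt_scale)
qed

lemma mon_mult_filt:
  assumes "0 \<notin> G" "f \<in> filt G (rk \<zeta>)" "\<zeta> \<in> expo n" "\<theta> \<in> expo n"
  shows "m \<theta> * f \<in> filt G (rk (\<theta> + \<zeta>))"
  using assms(2) unfolding filt_def
proof (rule lspan_mult_left, fold filt_def)
  fix r s assume r: "r \<in> R" and "s \<in> gens G (rk \<zeta>)"
  then obtain \<kappa> g where g: "\<kappa> \<in> expo n" "g \<in> G" "rk (\<kappa> + led g) < rk \<zeta>" "s = m \<kappa> * g"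
    by (auto simp: gens_def)
  then have nz: "g \<noteq> 0" using assms(1) by auto
  let ?t = "sp \<theta> r * mc \<theta> \<kappa>"
  have "rk (\<theta> + (\<kappa> + led g)) < rk (\<theta> + \<zeta>)"
    using g nz assms by (intro rk_add) (auto simp: lexp_expo)
  then have less: "rk (\<theta> + \<kappa> + led g) < rk (\<theta> + \<zeta>)" by (simp add: add.assoc)
  have "(m \<theta> * (r * m \<kappa>) - ?t * m (\<theta> + \<kappa>)) * g \<in> filt G (rk (\<theta> + \<zeta>))"
    using less g nz assms r by (intro low_mult_filt[OF mon_mult_term]) auto
  moreover have "?t * (m (\<theta> + \<kappa>) * g) \<in> filt G (rk (\<theta> + \<zeta>))"
    using less g nz assms r by (intro filt_scale filt_gen) auto
  ultimately have "(m \<theta> * (r * m \<kappa>) - ?t * m (\<theta> + \<kappa>)) * g + ?t * (m (\<theta> + \<kappa>) * g)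
    \<in> filt G (rk (\<theta> + \<zeta>))"
    by (rule filt_add)
  then show "m \<theta> * (r * s) \<in> filt G (rk (\<theta> + \<zeta>))"
    by (simp add: g algebra_simps)
qed

text \<open>
  Since \<open>A\<close> is spanned by monomials over \<open>R\<close>, the span of all \<open>x\<^sup>\<kappa> g\<close> is closed under left
  multiplication by \<open>A\<close>.
\<close>

lemma left_ideal_hull_filt:
  assumes "f \<in> left_ideal UNIV hull G"
  obtains k where "f \<in> filt G k"
proof -
  define S where "S = {m \<kappa> * g | \<kappa> g. \<kappa> \<in> expo n \<and> g \<in> G}"
  have all: "a \<in> lspan R (m ` expo n)" for a
    using supp_expo by (simp add: lspan_mon_iff)
  have mult: "a * g \<in> lspan R S" if "g \<in> G" for a g
    using all[of a]
  proof (rule lspan_mult_right)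
    show "r * (s * g) \<in> lspan R S" if "r \<in> R" "s \<in> m ` expo n" for r s
      using that \<open>g \<in> G\<close> by (intro lspan_scale lspan_base) (auto simp: S_def)
  qed
  have "left_ideal UNIV (lspan R S)"
    unfolding left_ideal_def
  proof (intro conjI ballI)
    fix s f assume "f \<in> lspan R S"
    then show "s * f \<in> lspan R S"
    proof (rule lspan_mult_left)
      fix r t assume "r \<in> R" "t \<in> S"
      then obtain \<kappa> g where "t = m \<kappa> * g" "g \<in> G" by (auto simp: S_def)
      then show "s * (r * t) \<in> lspan R S" using mult[of g "s * r * m \<kappa>"] by (simp add: mult.assoc)
    qed
  qed (auto intro: lspan.zero lspan_add)
  moreover have "G \<subseteq> lspan R S" using mult[of _ 1] by auto
  ultimately have "f \<in> lspan R S" using assms by (auto simp: hull_def)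
  then have "\<exists>k. f \<in> filt G k"
  proof induction
    case (step r s f)
    then obtain k \<kappa> g where "f \<in> filt G k" "s = m \<kappa> * g" "\<kappa> \<in> expo n" "g \<in> G" by (auto simp: S_def)
    let ?k = "max k (Suc (rk (\<kappa> + led g)))"
    have "s \<in> filt G ?k" unfolding \<open>s = _\<close> using \<open>\<kappa> \<in> _\<close> \<open>g \<in> G\<close> by (intro filt_gen) auto
    moreover have "f \<in> filt G ?k" using \<open>f \<in> filt G k\<close> by (rule filt_mono) simp
    ultimately have "r * s + f \<in> filt G ?k" using step by (intro filt_add filt_scale)
    then show ?case ..
  qed (auto intro: filt_zero)
  then show ?thesis using that by blast
qed

lemma expo_minus: "\<alpha> \<le> \<delta> \<Longrightarrow> \<delta> \<in> expo n \<Longrightarrow> \<delta> - \<alpha> \<in> expo n"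
  by (simp add: expo_def)

lemma expo_diff_add: "\<alpha> \<le> (\<delta> :: nat \<Rightarrow> nat) \<Longrightarrow> \<delta> - \<alpha> + \<alpha> = \<delta>"
  by (auto simp: fun_eq_iff le_fun_def)

text \<open>
  For given \<open>g\<close> at most one shift \<open>x\<^sup>\<kappa> g\<close> has leading exponent \<open>\<delta>\<close>, so the top summands can be
  collected into one coefficient for each \<open>g\<close> whose leading monomial divides \<open>x\<^sup>\<delta>\<close>.
\<close>

lemma filt_split_top:
  assumes "finite G" "0 \<notin> G" "\<delta> \<in> expo n" "f \<in> filt G (Suc (rk \<delta>))"
  obtains c where "\<forall>g. c g \<in> R"
    "f - (\<Sum>g | g \<in> G \<and> led g \<le> \<delta>. c g * (m (\<delta> - led g) * g)) \<in> filt G (rk \<delta>)"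
proof -
  let ?F = "{g \<in> G. led g \<le> \<delta>}"
  let ?T = "\<lambda>c. \<Sum>g\<in>?F. c g * (m (\<delta> - led g) * g)"
  have "\<exists>c. (\<forall>g. c g \<in> R) \<and> f - ?T c \<in> filt G (rk \<delta>)"
    using assms(4)[unfolded filt_def]
  proof induction
    case zero
    then show ?case by (intro exI[of _ "\<lambda>_. 0"]) (simp add: filt_zero)
  next
    case (step r s f)
    then obtain c where c: "\<And>g. c g \<in> R" "f - ?T c \<in> filt G (rk \<delta>)" by blast
    obtain \<kappa> g where g: "\<kappa> \<in> expo n" "g \<in> G" "rk (\<kappa> + led g) \<le> rk \<delta>" "s = m \<kappa> * g"
      using step by (auto simp: gens_def less_Suc_eq_le)
    then have "g \<noteq> 0" using assms(2) by auto
    then have led: "\<kappa> + led g \<in> expo n" using g(1) lexp_expo by simp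
    show ?case
    proof (cases "\<kappa> + led g = \<delta>")
      case True
      have \<kappa>: "led g \<le> \<delta>" "\<delta> - led g = \<kappa>"
        unfolding True[symmetric] by (auto simp: le_fun_def fun_eq_iff)
      define d where "d = (\<lambda>h. if h = g then r else 0)"
      have "?T d = (\<Sum>h\<in>?F. if h = g then r * (m (\<delta> - led h) * h) else 0)"
        by (rule sum.cong) (auto simp: d_def)
      also have "\<dots> = r * s" using g \<kappa> assms(1) by (simp add: sum.delta)
      finally have "?T (\<lambda>h. d h + c h) = r * s + ?T c" by (simp add: distrib_right sum.distrib)
      then have "r * s + f - ?T (\<lambda>h. d h + c h) = f - ?T c" by (simp only: add_diff_cancel_left)
      moreover have "d h + c h \<in> R" for h using c(1) step(1) by (simp add: d_def)
      ultimately show ?thesis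
        using c(2) by (intro exI[of _ "\<lambda>h. d h + c h"] conjI allI) (simp_all only:)
    next
      case False
      then have "rk (\<kappa> + led g) < rk \<delta>"
        using g rk_inj[OF led assms(3)] by linarith
      then have "s \<in> filt G (rk \<delta>)" unfolding g(4) using g by (intro filt_gen)
      then have "r * s + (f - ?T c) \<in> filt G (rk \<delta>)"
        using c(2) step(1) by (intro filt_add filt_scale)
      then have "r * s + f - ?T c \<in> filt G (rk \<delta>)" by (simp only: add_diff_eq)
      then show ?thesis using c(1) by blast
    qed
  qed
  then show ?thesis using that by blast
qed

section \<open>Reduction\<close>

text \<open>
  What a reduction step subtracts is a combination of shifts of \<open>G\<close> with the same leading exponent
  as \<open>f\<close>; this is how a reduction to \<open>0\<close> turns into a representation by \<open>G\<close>.
\<close>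

lemma red_step_split:
  assumes "red_step R n x ord G f h" "f \<in> below k"
  shows "f - h \<in> filt G k"
proof (cases "f = 0")
  case True
  then show ?thesis using assms(1) by (simp add: red_step_def filt_zero)
next
  case False
  then obtain t :: nat and g r \<alpha> where
    *: "\<forall>i<t. g i \<in> G \<and> r i \<in> R \<and> \<alpha> i \<in> expo n \<and> \<alpha> i + led (g i) = led f"
    and h: "h = f - (\<Sum>i<t. r i * m (\<alpha> i) * g i)"
    using assms(1) unfolding red_step_def by blast
  have "(\<Sum>i<t. r i * (m (\<alpha> i) * g i)) \<in> filt G k"
    using * assms(2) False below_lexp by (intro filt_sum filt_scale filt_gen) auto
  then show ?thesis by (simp add: h mult.assoc)
qed

text \<open>
  The condition on leading coefficients in a reduction step says precisely that the coefficients at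
  the leading exponent of \<open>f\<close> cancel.
\<close>

lemma red_step_decreases:
  assumes "red_step R n x ord G f h" "f \<noteq> 0" "0 \<notin> G"
  shows "h \<in> below (rk (led f))"
proof (rule below_cancel)
  obtain t :: nat and g r \<alpha> where
    *: "\<forall>i<t. g i \<in> G \<and> r i \<in> R \<and> \<alpha> i \<in> expo n \<and> \<alpha> i + led (g i) = led f"
    and lc: "lcf f = (\<Sum>i<t. r i * sp (\<alpha> i) (lcf (g i)) * mc (\<alpha> i) (led (g i)))"
    and h: "h = f - (\<Sum>i<t. r i * m (\<alpha> i) * g i)"
    using assms(1,2) unfolding red_step_def by blast
  have f: "f \<in> below (Suc (rk (led f)))" using assms(2) below_lexp by auto
  have "f - (f - h) \<in> below (Suc (rk (led f)))"
    using below_diff[OF f filt_below[OF assms(3) red_step_split[OF assms(1) f]]] .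
  then show "h \<in> below (Suc (rk (led f)))" by simp
  show "led f \<in> expo n" using assms(2) by (rule lexp_expo)
  have "cf (r i * m (\<alpha> i) * g i) (led f) = r i * sp (\<alpha> i) (lcf (g i)) * mc (\<alpha> i) (led (g i))"
    if "i < t" for i
    using * that assms(3) coef_mon_mult[of "g i" "\<alpha> i"]
    by (metis coef_scale mult.assoc)
  then show "cf h (led f) = 0"
    using lc assms(2) by (simp add: h coef_diff coef_sum lc_eq)
qed

lemma reduces_to_split:
  assumes "reduces_to R n x ord G f h" "f \<in> below k" "0 \<notin> G"
  shows "f - h \<in> filt G k"
proof -
  have "f - h \<in> filt G k \<and> h \<in> below k"
    using assms(1) unfolding reduces_to_def
  proof induction
    case (base h)
    note red_step_split[OF base assms(2)]
    then show ?case using below_diff[OF assms(2) filt_below[OF assms(3)]] by force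
  next
    case (step h h')
    then have split: "f - h \<in> filt G k" "h \<in> below k" "h - h' \<in> filt G k"
      using red_step_split by blast+
    from filt_add[OF split(1,3)] below_diff[OF split(2) filt_below[OF assms(3) split(3)]]
    show ?case by simp
  qed
  then show ?thesis ..
qed

text \<open>
  Reduction cannot get stuck inside \<open>I\<close> and terminates because ranks decrease.  For \<open>f = 0\<close> the
  required reduction is the conventional step from \<open>0\<close> to \<open>0\<close>.
\<close>

lemma reduces_to_zero:
  assumes "left_ideal UNIV I" "G \<subseteq> I - {0}" "\<And>f. f \<in> I - {0} \<Longrightarrow> reducible R n x ord G f"
    and "f \<in> I"
  shows "reduces_to R n x ord G f 0"
proof -
  have G0: "0 \<notin> G" using assms(2) by auto
  have "reduces_to R n x ord G f 0" if "f \<in> I" "f \<in> below k" for f k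
    using that
  proof (induction k arbitrary: f rule: less_induct)
    case (less k)
    show ?case
    proof (cases "f = 0")
      case True
      then show ?thesis by (auto simp: reduces_to_def red_step_def)
    next
      case False
      then have "reducible R n x ord G f" using assms(3) less.prems by simp
      then obtain h where h: "red_step R n x ord G f h" by (auto simp: reducible_def)
      obtain t :: nat and g r \<alpha> where
        *: "\<forall>i<t. g i \<in> G" "h = f - (\<Sum>i<t. r i * m (\<alpha> i) * g i)"
        using h False unfolding red_step_def by blast
      have I: "0 \<in> I" "\<And>a b. a \<in> I \<Longrightarrow> b \<in> I \<Longrightarrow> a + b \<in> I" "\<And>a b. b \<in> I \<Longrightarrow> a * b \<in> I"
        using assms(1) by (auto simp: left_ideal_def)
      have "(\<Sum>i<t. r i * m (\<alpha> i) * g i) \<in> I"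
        using * assms(1,2) by (intro left_ideal_sum) auto
      then have "f + (- 1) * (\<Sum>i<t. r i * m (\<alpha> i) * g i) \<in> I"
        using less.prems by (intro I)
      then have "h \<in> I" by (simp add: *)
      moreover have "rk (led f) < k" using less.prems False below_lexp by blast
      ultimately have "reduces_to R n x ord G h 0"
        using less.IH red_step_decreases[OF h False G0] by blast
      with h show ?thesis unfolding reduces_to_def by (rule tranclp_into_tranclp2)
    qed
  qed
  moreover obtain k where "f \<in> below k"
    by (cases "f = 0") (auto simp: below_lexp below_zero)
  ultimately show ?thesis using assms(4) by blast
qed

lemma reducibleI:
  assumes "finite F" "F \<subseteq> G" "c \<in> F \<rightarrow> R" "f \<noteq> 0" "\<And>g. g \<in> F \<Longrightarrow> led g \<le> led f"
    and lc: "lcf f = (\<Sum>g\<in>F. c g * sp (led f - led g) (lcf g) * mc (led f - led g) (led g))"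
  shows "reducible R n x ord G f"
proof -
  obtain e where e: "bij_betw e {..<card F} F"
    using ex_bij_betw_nat_finite[OF assms(1)] by (auto simp: atLeast0LessThan)
  then have eF: "e i \<in> F" if "i < card F" for i
    using that by (auto simp: bij_betw_def)
  have "lcf f = (\<Sum>i<card F. c (e i) * sp (led f - led (e i)) (lcf (e i)) * mc (led f - led (e i)) (led (e i)))"
    unfolding lc by (rule sum.reindex_bij_betw[OF e, symmetric])
  moreover have "\<forall>i<card F. e i \<in> G \<and> c (e i) \<in> R \<and> led f - led (e i) \<in> expo n \<and>
      led f - led (e i) + led (e i) = led f"
    using assms eF lexp_expo[OF assms(4)] by (auto intro: expo_minus simp: expo_diff_add)
  ultimately have "red_step R n x ord G f
      (f - (\<Sum>i<card F. c (e i) * m (led f - led (e i)) * e i))"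
    unfolding red_step_def using assms(4)
    by (intro disjI2 conjI exI[of _ "card F"] exI[of _ e] exI[of _ "\<lambda>i. c (e i)"]
        exI[of _ "\<lambda>i. led f - led (e i)"]) auto
  then show ?thesis using assms(4) by (auto simp: reducible_def)
qed

section \<open>Lifting syzygies of the leading coefficients\<close>

lemma cofactor_add:
  assumes "finite F" "g \<in> F"
  shows "cofactor_exp R n x ord F g + led g = lcm_exp R n x ord F"
proof -
  have le: "led g \<le> lcm_exp R n x ord F"
    using assms by (auto simp: le_fun_def lcm_exp_def intro!: Max_ge)
  have "cofactor_exp R n x ord F g = lcm_exp R n x ord F - led g"
    by (simp add: cofactor_exp_def fun_eq_iff)
  then show ?thesis
    using le by (simp add: expo_diff_add)
qed

lemma lcm_exp_le:
  assumes "finite F" "F \<noteq> {}" "\<And>g. g \<in> F \<Longrightarrow> led g \<le> \<delta>"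
  shows "lcm_exp R n x ord F \<le> \<delta>"
  using assms by (auto simp: le_fun_def lcm_exp_def)

lemma expo_down: "\<alpha> \<le> \<delta> \<Longrightarrow> \<delta> \<in> expo n \<Longrightarrow> \<alpha> \<in> expo n"
  by (auto simp: expo_def le_fun_def) (metis le_zero_eq)

lemma lcm_exp_expo:
  assumes "finite F" "F \<noteq> {}" "0 \<notin> F"
  shows "lcm_exp R n x ord F \<in> expo n"
proof -
  have "led g \<in> expo n" if "g \<in> F" for g
    using that assms(3) lexp_expo by metis
  then have "(\<lambda>g. led g i) ` F = {0}" if "i \<ge> n" for i
    using that assms(2) by (auto simp: expo_def)
  then show ?thesis by (simp add: expo_def lcm_exp_def)
qed

text \<open>
  All summands have the leading exponent \<open>\<zeta>\<close>, and the syzygy condition is the vanishing of the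
  coefficient there.
\<close>

lemma syzygy_combination:
  fixes F defines "\<gamma> \<equiv> cofactor_exp R n x ord F" and "\<zeta> \<equiv> lcm_exp R n x ord F"
  assumes "finite F" "F \<noteq> {}" "0 \<notin> F" "b \<in> lc_syz R n x ord F"
  shows "(\<Sum>g\<in>F. b g * m (\<gamma> g) * g) \<in> below (rk \<zeta>)"
proof (rule below_cancel)
  have \<zeta>: "\<zeta> \<in> expo n" unfolding \<zeta>_def using assms by (intro lcm_exp_expo)
  then show "\<zeta> \<in> expo n" .
  have b: "b g \<in> R" if "g \<in> F" for g
    using assms(6) that by (auto simp: lc_syz_def Syz_def)
  have sum: "\<gamma> g + led g = \<zeta>" if "g \<in> F" for g
    using that assms(3) cofactor_add by (simp add: \<gamma>_def \<zeta>_def)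
  have \<gamma>: "\<gamma> g \<in> expo n" if "g \<in> F" for g
    using sum[OF that, symmetric] \<zeta> by (auto simp: expo_def)
  have nz: "g \<noteq> 0" if "g \<in> F" for g using that assms(5) by auto
  have "(\<Sum>g\<in>F. b g * (m (\<gamma> g) * g)) \<in> filt F (Suc (rk \<zeta>))"
    using b sum \<gamma> by (intro filt_sum filt_scale filt_gen) auto
  then show "(\<Sum>g\<in>F. b g * m (\<gamma> g) * g) \<in> below (Suc (rk \<zeta>))"
    using filt_below[OF assms(5)] by (simp add: mult.assoc)
  have "cf (b g * m (\<gamma> g) * g) \<zeta> = b g * (sp (\<gamma> g) (lcf g) * mc (\<gamma> g) (led g))" if "g \<in> F" for g
    using coef_mon_mult[OF nz[OF that] \<gamma>[OF that]] b[OF that] sum[OF that]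
    by (simp add: mult.assoc coef_scale)
  then show "cf (\<Sum>g\<in>F. b g * m (\<gamma> g) * g) \<zeta> = 0"
    using assms(6) by (simp add: coef_sum lc_syz_def Syz_def \<gamma>_def)
qed

text \<open>
  Cancelling top summands at an arbitrary exponent \<open>\<delta>\<close> is reduced to cancellation at the least
  common multiple.  The coefficients \<open>c\<^sub>g\<close> are written as \<open>\<sigma>\<^sup>\<theta>(d\<^sub>g) c\<^bsub>\<theta>,\<gamma>\<^sub>g\<^esub>\<close>, so that
  \<open>c\<^sub>g x\<^bsup>\<theta>+\<gamma>\<^sub>g\<^esup>\<close> is the main part of \<open>x\<^sup>\<theta> d\<^sub>g x\<^bsup>\<gamma>\<^sub>g\<^esup>\<close>; then \<open>d\<close> is a syzygy at the least common
  multiple.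
\<close>

lemma lift_syzygy:
  assumes "finite F" "F \<subseteq> G" "F \<noteq> {}" "0 \<notin> G" "\<delta> \<in> expo n" "\<And>g. g \<in> F \<Longrightarrow> led g \<le> \<delta>"
    and c: "c \<in> F \<rightarrow> R"
    and c0: "(\<Sum>g\<in>F. c g * sp (\<delta> - led g) (lcf g) * mc (\<delta> - led g) (led g)) = 0"
    and B: "finite_generating_set R F (lc_syz R n x ord F) B"
    and red: "\<And>b. b \<in> B \<Longrightarrow>
      (\<Sum>g\<in>F. b g * m (cofactor_exp R n x ord F g) * g) \<in> filt G (rk (lcm_exp R n x ord F))"
  shows "(\<Sum>g\<in>F. c g * (m (\<delta> - led g) * g)) \<in> filt G (rk \<delta>)"
proof -
  define \<gamma> where "\<gamma> = cofactor_exp R n x ord F"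
  define \<zeta> where "\<zeta> = lcm_exp R n x ord F"
  define \<theta> where "\<theta> = \<delta> - \<zeta>"
  define s where "s g = sp (\<gamma> g) (lcf g) * mc (\<gamma> g) (led g)" for g
  have "\<zeta> \<le> \<delta>" unfolding \<zeta>_def using assms by (intro lcm_exp_le)
  then have \<delta>: "\<delta> = \<theta> + \<zeta>" and \<theta>: "\<theta> \<in> expo n" and \<zeta>: "\<zeta> \<in> expo n"
    using assms(5) by (auto simp: \<theta>_def expo_diff_add expo_minus intro: expo_down)
  have sum: "\<gamma> g + led g = \<zeta>" if "g \<in> F" for g
    using that assms(1) cofactor_add by (simp add: \<gamma>_def \<zeta>_def)
  have \<gamma>: "\<gamma> g \<in> expo n" if "g \<in> F" for g
    using sum[OF that, symmetric] \<zeta> by (auto simp: expo_def)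
  have diff: "\<delta> - led g = \<theta> + \<gamma> g" if "g \<in> F" for g
    unfolding \<delta> sum[OF that, symmetric] by (simp add: fun_eq_iff)
  have nz: "g \<noteq> 0" if "g \<in> F" for g using that assms by auto
  have led: "led g \<in> expo n" "lcf g \<in> R" if "g \<in> F" for g
    using nz[OF that] lexp_expo lc_in by auto
  have s: "s g \<in> R" if "g \<in> F" for g
    using that led \<gamma> by (simp add: s_def)
  have "\<exists>d. d \<in> R \<and> sp \<theta> d * mc \<theta> (\<gamma> g) = c g" if g: "g \<in> F" for g
  proof -
    obtain e where e: "unit e" "e * mc \<theta> (\<gamma> g) = 1"
      using unit_mult_coeff[OF \<theta> \<gamma>[OF g]] by (metis unit_inverse)
    have "c g * e \<in> R" using funcset_mem[OF c g] unit_in[OF e(1)] by (rule R_mult)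
    then obtain d where "d \<in> R" "sp \<theta> d = c g * e"
      using sigma_pow_bij[of \<theta>] by (metis bij_betw_def imageE)
    then show ?thesis using e by (auto simp: mult.assoc)
  qed
  then obtain d where d: "\<And>g. g \<in> F \<Longrightarrow> d g \<in> R"
    and cd: "\<And>g. g \<in> F \<Longrightarrow> sp \<theta> (d g) * mc \<theta> (\<gamma> g) = c g"
    by metis
  \<comment> \<open>By the cocycle identity the given relation is the image under \<open>\<sigma>\<^sup>\<theta>\<close>, times the unit
     \<open>c\<^bsub>\<theta>,\<zeta>\<^esub>\<close>, of a relation between the \<open>s g\<close>.\<close>
  have "sp \<theta> (\<Sum>g\<in>F. d g * s g) * mc \<theta> \<zeta> = (\<Sum>g\<in>F. sp \<theta> (d g) * (sp \<theta> (s g) * mc \<theta> \<zeta>))"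
    using d s by (simp add: sigma_pow_sum sigma_pow_mult sum_distrib_right mult.assoc)
  also have "\<dots> = (\<Sum>g\<in>F. c g * sp (\<delta> - led g) (lcf g) * mc (\<delta> - led g) (led g))"
  proof (rule sum.cong[OF refl])
    fix g assume g: "g \<in> F"
    have "sp \<theta> (s g) * mc \<theta> \<zeta> = mc \<theta> (\<gamma> g) * (sp (\<theta> + \<gamma> g) (lcf g) * mc (\<theta> + \<gamma> g) (led g))"
      using mult_coeff_assoc[OF \<theta> \<gamma>[OF g] led[OF g]] sum[OF g] by (simp add: s_def)
    then show "sp \<theta> (d g) * (sp \<theta> (s g) * mc \<theta> \<zeta>) =
        c g * sp (\<delta> - led g) (lcf g) * mc (\<delta> - led g) (led g)"
      by (simp add: diff[OF g] cd[OF g, symmetric] mult.assoc)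
  qed
  finally have zero: "sp \<theta> (\<Sum>g\<in>F. d g * s g) * mc \<theta> \<zeta> = 0" using c0 by simp
  obtain e where "mc \<theta> \<zeta> * e = 1"
    using unit_mult_coeff[OF \<theta> \<zeta>] by (metis unit_inverse)
  then have "sp \<theta> (\<Sum>g\<in>F. d g * s g) = sp \<theta> 0"
    using zero by (metis mult.assoc mult_1_right mult_zero_left sigma_pow_zero)
  then have "(\<Sum>g\<in>F. d g * s g) = 0"
    by (rule inj_onD[OF bij_betw_imp_inj_on[OF sigma_pow_bij]]) (use d s in \<open>auto intro!: R_sum\<close>)
  then have "(\<lambda>g\<in>F. d g) \<in> lc_syz R n x ord F"
    using d by (auto simp: lc_syz_def Syz_def s_def \<gamma>_def)
  then obtain a where a: "a \<in> B \<rightarrow> R" "(\<lambda>g\<in>F. d g) = (\<lambda>g\<in>F. \<Sum>b\<in>B. a b * b g)"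
    using B unfolding finite_generating_set_def by blast
  have da: "d g = (\<Sum>b\<in>B. a b * b g)" if "g \<in> F" for g
    using fun_cong[OF a(2), of g] that by simp
  have "(\<Sum>g\<in>F. d g * m (\<gamma> g) * g) = (\<Sum>g\<in>F. \<Sum>b\<in>B. a b * (b g * m (\<gamma> g) * g))"
    by (rule sum.cong) (simp_all add: da sum_distrib_right mult.assoc)
  also have "\<dots> = (\<Sum>b\<in>B. a b * (\<Sum>g\<in>F. b g * m (\<gamma> g) * g))"
    by (subst sum.swap) (simp add: sum_distrib_left)
  also have "\<dots> \<in> filt G (rk \<zeta>)"
  proof (rule filt_sum)
    fix b assume "b \<in> B"
    then show "a b * (\<Sum>g\<in>F. b g * m (\<gamma> g) * g) \<in> filt G (rk \<zeta>)"
      unfolding \<gamma>_def \<zeta>_def using a(1) by (intro filt_scale[OF red]) auto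
  qed
  finally have main: "m \<theta> * (\<Sum>g\<in>F. d g * m (\<gamma> g) * g) \<in> filt G (rk \<delta>)"
    unfolding \<delta> using assms(4) \<theta> \<zeta> by (intro mon_mult_filt)
  \<comment> \<open>Commuting \<open>x\<^sup>\<theta>\<close> past \<open>d g\<close> and merging monomials leaves terms of lower degree.\<close>
  have rest: "(\<Sum>g\<in>F. (m \<theta> * (d g * m (\<gamma> g)) - c g * m (\<theta> + \<gamma> g)) * g) \<in> filt G (rk \<delta>)"
  proof (rule filt_sum)
    fix g assume g: "g \<in> F"
    have "\<theta> + \<gamma> g + led g = \<delta>" by (simp add: \<delta> add.assoc sum[OF g])
    then show "(m \<theta> * (d g * m (\<gamma> g)) - c g * m (\<theta> + \<gamma> g)) * g \<in> filt G (rk \<delta>)"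
      using mon_mult_term[OF \<theta> \<gamma>[OF g] d[OF g]] g \<theta> \<gamma>[OF g] nz[OF g] assms(2)
      by (intro low_mult_filt[of _ "\<theta> + \<gamma> g"]) (auto simp: cd)
  qed
  have "m \<theta> * (\<Sum>g\<in>F. d g * m (\<gamma> g) * g) -
      (\<Sum>g\<in>F. (m \<theta> * (d g * m (\<gamma> g)) - c g * m (\<theta> + \<gamma> g)) * g) =
    (\<Sum>g\<in>F. c g * (m (\<delta> - led g) * g))"
    unfolding sum_distrib_left sum_subtractf[symmetric]
    by (rule sum.cong) (simp_all add: diff algebra_simps)
  then show ?thesis using filt_diff[OF main rest] by simp
qed

section \<open>The Buchberger criterion\<close>

text \<open>
  The induction lowers the member of the filtration that contains \<open>f\<close>, not \<open>f\<close> itself: at a top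
  exponent either a reduction step of \<open>f\<close> is visible or \<open>f\<close> has a representation with smaller
  leading exponents.
\<close>

lemma reducible_of_syzygies:
  assumes "finite G" "0 \<notin> G"
    and B: "\<And>F. F \<subseteq> G \<Longrightarrow> F \<noteq> {} \<Longrightarrow>
      finite_generating_set R F (lc_syz R n x ord F) (B F)"
    and red: "\<And>F b. F \<subseteq> G \<Longrightarrow> F \<noteq> {} \<Longrightarrow> b \<in> B F \<Longrightarrow>
      reduces_to R n x ord G (\<Sum>g\<in>F. b g * m (cofactor_exp R n x ord F g) * g) 0"
  shows "f \<in> filt G k \<Longrightarrow> f \<noteq> 0 \<Longrightarrow> reducible R n x ord G f"
proof (induction k arbitrary: f)
  case 0
  then have "f \<in> below 0" using filt_below assms(2) by blast
  then show ?case using 0 below_lexp by auto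
next
  case (Suc k)
  show ?case
  proof (cases "\<exists>\<delta>\<in>expo n. rk \<delta> = k")
    case False
    \<comment> \<open>No exponent has rank \<open>k\<close>, so nothing is added at this stage.\<close>
    have "gens G (Suc k) = gens G k"
    proof -
      have "rk (\<kappa> + led g) \<noteq> k" if "\<kappa> \<in> expo n" "g \<in> G" for \<kappa> g
        using False that assms(2) lexp_expo by (metis expo_add)
      then show ?thesis by (auto simp: gens_def less_Suc_eq)
    qed
    then show ?thesis using Suc by (simp add: filt_def)
  next
    case True
    then obtain \<delta> where \<delta>: "\<delta> \<in> expo n" "rk \<delta> = k" by auto
    let ?F = "{g \<in> G. led g \<le> \<delta>}"
    have F: "finite ?F" "?F \<subseteq> G" using assms(1) by auto
    have "f \<in> filt G (Suc (rk \<delta>))" using Suc.prems(1) \<delta>(2) by simp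
    then obtain c where c: "\<forall>g. c g \<in> R"
      and rem: "f - (\<Sum>g\<in>?F. c g * (m (\<delta> - led g) * g)) \<in> filt G (rk \<delta>)"
      by (rule filt_split_top[OF assms(1,2) \<delta>(1)])
    have "cf (c g * (m (\<delta> - led g) * g)) \<delta> =
        c g * sp (\<delta> - led g) (lcf g) * mc (\<delta> - led g) (led g)" if "g \<in> ?F" for g
    proof -
      have "g \<noteq> 0" "\<delta> - led g \<in> expo n" "\<delta> - led g + led g = \<delta>"
        using that assms(2) \<delta> by (auto simp: expo_minus expo_diff_add)
      then show ?thesis
        using coef_mon_mult[of g "\<delta> - led g"] c
        by (simp add: coef_scale mult.assoc)
    qed
    moreover have "cf (f - (\<Sum>g\<in>?F. c g * (m (\<delta> - led g) * g))) \<delta> = 0"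
      using filt_below[OF assms(2) rem] by (auto simp: below_def)
    ultimately have top: "cf f \<delta> =
        (\<Sum>g\<in>?F. c g * sp (\<delta> - led g) (lcf g) * mc (\<delta> - led g) (led g))"
      by (simp add: coef_diff coef_sum)
    show ?thesis
    proof (cases "cf f \<delta> = 0")
      case False
      have "f \<in> below (Suc k)" using filt_below[OF assms(2) Suc.prems(1)] .
      then have "led f = \<delta>"
        using False \<delta>(2) by (intro lexp_eqI) (auto simp: below_def less_Suc_eq_le)
      then show ?thesis
        using top F Suc.prems(2) c by (intro reducibleI[of ?F]) (auto simp: lc_eq)
    next
      case True
      have "(\<Sum>g\<in>?F. c g * (m (\<delta> - led g) * g)) \<in> filt G (rk \<delta>)"
      proof (cases "?F = {}")
        case False
        have F0: "0 \<notin> ?F" using assms(2) by auto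
        show ?thesis
        proof (rule lift_syzygy[OF F False assms(2) \<delta>(1) _ _ _ B[OF F(2) False]])
          fix b assume b: "b \<in> B ?F"
          let ?u = "\<Sum>g\<in>?F. b g * m (cofactor_exp R n x ord ?F g) * g"
          have "b \<in> lc_syz R n x ord ?F"
            using B[OF F(2) False] b by (auto simp: finite_generating_set_def)
          then have "?u \<in> below (rk (lcm_exp R n x ord ?F))"
            by (rule syzygy_combination[OF F(1) False F0])
          then show "?u \<in> filt G (rk (lcm_exp R n x ord ?F))"
            using reduces_to_split[OF red[OF F(2) False b] _ assms(2)] by simp
        qed (use c top True in auto)
      qed (simp only: sum.empty filt_zero)
      with rem have "(f - (\<Sum>g\<in>?F. c g * (m (\<delta> - led g) * g))) +
          (\<Sum>g\<in>?F. c g * (m (\<delta> - led g) * g)) \<in> filt G k"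
        unfolding \<delta>(2)[symmetric] by (rule filt_add)
      then show ?thesis using Suc by simp
    qed
  qed
qed

end

theorem theorem101:
  fixes R :: "'a::ring_1 set" and n :: nat and x :: "nat \<Rightarrow> 'a"
    and C :: "'c set" and val :: "'c \<Rightarrow> 'a" and Alg :: "('c list \<Rightarrow> 'c list list option) set"
    and ord :: "'a rel" and I G :: "'a set" and B :: "'a set \<Rightarrow> ('a \<Rightarrow> 'a) set"
  assumes "bijective_skew_PBW R n x"
    and "LGS C val Alg R"
    and "monomial_order R n x ord"
    and "left_ideal UNIV I" and "I \<noteq> {0}"
    and "finite G" and "G \<subseteq> I - {0}" and "left_ideal UNIV hull G = I"
    and "\<And>F. F \<subseteq> G \<Longrightarrow> F \<noteq> {} \<Longrightarrow>
           finite_generating_set R F (lc_syz R n x ord F) (B F)"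
  shows "groebner_basis R n x ord I G \<longleftrightarrow>
    (\<forall>F b. F \<subseteq> G \<and> F \<noteq> {} \<and> b \<in> B F \<longrightarrow>
       reduces_to R n x ord G
         (\<Sum>g\<in>F. b g * mon n x (cofactor_exp R n x ord F g) * g) 0)"
proof -
  interpret ordered_skew_PBW R n x ord
    by (intro ordered_skew_PBW.intro skew_PBW_extension.intro ordered_skew_PBW_axioms.intro assms)
  have I: "0 \<in> I" "\<And>a b. a \<in> I \<Longrightarrow> b \<in> I \<Longrightarrow> a + b \<in> I" "\<And>a b. b \<in> I \<Longrightarrow> a * b \<in> I"
    using assms(4) by (auto simp: left_ideal_def)
  show ?thesis
  proof (intro iffI allI impI)
    fix F b
    assume G: "groebner_basis R n x ord I G" and F: "F \<subseteq> G \<and> F \<noteq> {} \<and> b \<in> B F"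
    have "(\<Sum>g\<in>F. b g * mon n x (cofactor_exp R n x ord F g) * g) \<in> I"
      using F assms(4,7) by (intro left_ideal_sum) auto
    then show "reduces_to R n x ord G (\<Sum>g\<in>F. b g * mon n x (cofactor_exp R n x ord F g) * g) 0"
      using G assms(4,5,7) by (intro reduces_to_zero[of I]) (auto simp: groebner_basis_def)
  next
    assume red: "\<forall>F b. F \<subseteq> G \<and> F \<noteq> {} \<and> b \<in> B F \<longrightarrow> reduces_to R n x ord G
      (\<Sum>g\<in>F. b g * mon n x (cofactor_exp R n x ord F g) * g) 0"
    have "0 \<notin> G" using assms(7) by auto
    have reducible: "reducible R n x ord G f" if "f \<in> I - {0}" for f
    proof -
      have "f \<in> left_ideal UNIV hull G" using that assms(8) by simp
      then obtain k where "f \<in> filt G k" by (rule left_ideal_hull_filt)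
      then show ?thesis
        using reducible_of_syzygies[OF assms(6) \<open>0 \<notin> G\<close> assms(9)] red that by blast
    qed
    have "G \<noteq> {}"
    proof
      assume "G = {}"
      moreover have "left_ideal UNIV {0::'a}" by (simp add: left_ideal_def)
      ultimately have "I \<subseteq> {0}" using assms(8) hull_minimal[of G "{0}" "left_ideal UNIV"] by auto
      then show False using I(1) assms(5) by auto
    qed
    then show "groebner_basis R n x ord I G"
      using assms(5,6,7) reducible by (simp add: groebner_basis_def)
  qed
qed

end
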